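(* Fix $k<m$. Let $V=0\times\mathbb R^{m-1}\subset\mathbb R^m$, regarded as a constant hyperplane field on $I^m$, and let $\sigma:I^m\to J^r(\mathbb R^m,\mathbb R^n)$ be a section such that $\sigma=0$ on an open neighborhood of $\partial I^m$ and $\sigma^\perp=0$ on all of $I^m$ with respect to $V$. Then for every $\varepsilon>0$ there exist an isotopy $F_t:I^m\to I^m$ and a holonomic section $\hat\sigma$ such that: $\mathrm{dist}_{C^0}(\hat\sigma,\sigma)<\varepsilon$ on an open neighborhood of $F_1(I^k)$; $\|\hat\sigma^\perp\|_{C^0}<\varepsilon$ on all of $I^m$; $\mathrm{dist}_{C^0}(F_t,\mathrm{id})<\varepsilon$; $F_t=\mathrm{id}_{I^m}$ and $\hat\sigma=0$ on an open neighborhood of $\partial I^m$; and $V$ is invariant under $F_t$ (i.e. $dF_t(V)=V$).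
   Context: $I=[-1,1]$, $I^k=I^k\times\{0\}^{m-k}\subset I^m$. $J^r(\mathbb R^m,\mathbb R^n)\cong\mathbb R^m\times(\mathcal P_r)^n$ via Taylor polynomials of degree $\le r$; $0$ is the jet of the zero map; holonomic means of the form $j^r(h)$. For the hyperplane field $V$, $\sigma^\perp$ of $j^r(h)(x)$ consists of the $(r-1)$-jet of $h$ and all derivatives $\partial_\nu\partial_\alpha h(x)$ with $|\alpha|=r-1$, $\nu\in V$; equivalently, all partial derivatives of order $\le r$ except the pure derivative $\partial_1^r$. *)

theory Defs
  imports "HOL-Analysis.Analysis"
begin

definition dirderiv :: "'a::real_normed_vector \<Rightarrow> ('a \<Rightarrow> real) \<Rightarrow> 'a \<Rightarrow> real" where
  "dirderiv v f x = deriv (\<lambda>t. f (x + t *\<^sub>R v)) 0"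

fun iter_dirderiv :: "'a::real_normed_vector list \<Rightarrow> ('a \<Rightarrow> real) \<Rightarrow> 'a \<Rightarrow> real" where
  "iter_dirderiv [] f = f"
| "iter_dirderiv (v # vs) f = dirderiv v (iter_dirderiv vs f)"

definition smooth_fun :: "('a::euclidean_space \<Rightarrow> real) \<Rightarrow> bool" where
  "smooth_fun f \<longleftrightarrow> (\<forall>vs x. set vs \<subseteq> Basis \<longrightarrow> iter_dirderiv vs f differentiable (at x))"

definition smooth_map :: "('a::euclidean_space \<Rightarrow> 'b::euclidean_space) \<Rightarrow> bool" where
  "smooth_map f \<longleftrightarrow> (\<forall>c\<in>Basis. smooth_fun (\<lambda>x. f x \<bullet> c))"

text \<open>The cube I^m = [-1,1]^m; coordinates are indexed by a finite well-ordered type,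
  the i-th coordinate having rank card {j. j < i} (ranks 0..m-1).\<close>
definition cube :: "(real^'m) set" where
  "cube = {x. \<forall>i. \<bar>x $ i\<bar> \<le> 1}"

definition crank :: "'m::{finite,wellorder} \<Rightarrow> nat" where
  "crank i = card {j. j < i}"

definition subcube :: "nat \<Rightarrow> (real^'m::{finite,wellorder}) set" where
  "subcube k = {x \<in> cube. \<forall>i. k \<le> crank i \<longrightarrow> x $ i = 0}"

definition e1 :: "'m::wellorder" where
  "e1 = (LEAST i. True)"

definition hypV :: "(real^'m::{finite,wellorder}) set" where
  "hypV = {v. v $ e1 = 0}"

definition mi_deg :: "('m::finite \<Rightarrow> nat) \<Rightarrow> nat" where
  "mi_deg \<alpha> = (\<Sum>i\<in>UNIV. \<alpha> i)"

definition pure1 :: "nat \<Rightarrow> ('m::wellorder \<Rightarrow> nat)" where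
  "pure1 r = (\<lambda>i. if i = e1 then r else 0)"

definition pderiv_mi :: "('m::{finite,wellorder} \<Rightarrow> nat) \<Rightarrow> ((real, 'm) vec \<Rightarrow> real) \<Rightarrow> (real, 'm) vec \<Rightarrow> real" where
  "pderiv_mi \<alpha> f = iter_dirderiv
      (concat (map (\<lambda>i. replicate (\<alpha> i) (axis i (1::real))) (sorted_list_of_set UNIV))) f"

text \<open>Jet fibre coordinates: a section sigma of J^r(R^m,R^n) over I^m is represented by
  its fibre part sigma x alpha j (the coefficient for the derivative d^alpha of the j-th component),
  only multi-indices with mi_deg alpha <= r being meaningful.\<close>
definition jet_coords :: "nat \<Rightarrow> ('m::finite \<Rightarrow> nat) set" where
  "jet_coords r = {\<alpha>. mi_deg \<alpha> \<le> r}"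

definition perp_coords :: "nat \<Rightarrow> ('m::{finite,wellorder} \<Rightarrow> nat) set" where
  "perp_coords r = {\<alpha>. mi_deg \<alpha> \<le> r \<and> \<alpha> \<noteq> pure1 r}"

definition jet :: "nat \<Rightarrow> ((real, 'm::{finite,wellorder}) vec \<Rightarrow> real^'n) \<Rightarrow> (real, 'm) vec \<Rightarrow> ('m \<Rightarrow> nat) \<Rightarrow> 'n \<Rightarrow> real" where
  "jet r h x = (\<lambda>\<alpha> j. if mi_deg \<alpha> \<le> r then pderiv_mi \<alpha> (\<lambda>y. h y $ j) x else 0)"

definition diffeo_cube :: "(real^'m \<Rightarrow> real^'m) \<Rightarrow> bool" where
  "diffeo_cube F \<longleftrightarrow> smooth_map F \<and> F ` cube = cube \<and>
     (\<exists>G. smooth_map G \<and> (\<forall>x\<in>cube. G (F x) = x))"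

definition isotopy :: "(real \<Rightarrow> real^'m \<Rightarrow> real^'m) \<Rightarrow> bool" where
  "isotopy F \<longleftrightarrow> smooth_map (\<lambda>p :: real \<times> (real^'m). F (fst p) (snd p)) \<and>
     (\<forall>x\<in>cube. F 0 x = x) \<and> (\<forall>t\<in>{0..1}. diffeo_cube (F t))"

end

(* The section is concentrated in the pure derivative along the first coordinate x_1.  The identity
   2 v cos u - cos (2 u) = 1 on the curve v = cos u exhibits a function which equals 1 on the graph of
   the cosine but has mean zero in u for every fixed v, so that its r-fold antiderivative in u is
   again a trigonometric polynomial.  Rescaling u = x_1 / delta and multiplying the antiderivative by
   delta ^ r makes all derivatives of order at most r tend to 0 with delta, except the pure
   derivative along x_1.  So, with s a smooth approximation of the only nonzero component of the
   section and v = x_l / a for the last coordinate x_l, the holonomic section is the jet of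
     s(x) delta^r [2 v cos (u - r pi / 2) - 2^(-r) cos (2 u - r pi / 2)],
   and the isotopy is the shear x_l |-> x_l + t psi(x) a cos (x_1 / delta), psi being a cutoff. *)

theory Submission
  imports Defs
begin

text \<open>For r >= 1, a pure derivative staying near a nonzero constant along a fixed segment in
  direction x_1 is incompatible with arbitrarily small lower derivatives. Hence closeness to the
  section is arranged only near a wiggled subcube, which meets the oscillation where it has the
  right value. The phase -r pi/2 undoes the r quarter turns caused by differentiating a cosine r
  times, and 2^(-r) undoes the inner factor 2. The last coordinate is used because it vanishes on
  I^k when k < m; a displacement along it preserves V as soon as it differs from x_1. The amplitude
  a has to be fixed before delta, since the coefficient v = x_l / a enters the error constants that
  determine delta. This order is possible because cos (x_1 / delta) is constant along x_l, so delta
  does not enter the bound that makes the shear invertible. For m = 1 the last coordinate is x_1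
  itself. Then I^0 is the origin, where cos (2 u) = 1 already, so the shear is the identity and the
  second harmonic alone, with positive sign, is enough.\<close>

section \<open>Smooth functions\<close>

lemma dirderiv_eq:
  assumes "(f has_derivative f') (at x)"
  shows "dirderiv v f x = f' v"
proof -
  have "((\<lambda>t. f (x + t *\<^sub>R v)) has_derivative (\<lambda>t. f' (t *\<^sub>R v))) (at 0)"
    by (rule has_derivative_compose[of _ "\<lambda>t. t *\<^sub>R v" 0 UNIV f f', simplified])
      (auto intro!: derivative_eq_intros simp: assms)
  moreover have "(\<lambda>t. f' (t *\<^sub>R v)) = (\<lambda>t. f' v * t)"
    using linear_scale[OF has_derivative_linear[OF assms]] by (auto simp: mult.commute)
  ultimately show ?thesis
    unfolding dirderiv_def by (intro DERIV_imp_deriv) (simp add: has_field_derivative_def)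
qed

lemma has_derivative_dirderiv:
  assumes "f differentiable (at x)"
  shows "(f has_derivative (\<lambda>v. dirderiv v f x)) (at x)"
proof -
  from assms obtain f' where f': "(f has_derivative f') (at x)"
    unfolding differentiable_def by blast
  then show ?thesis using dirderiv_eq[OF f'] by simp
qed

lemma dirderiv_add:
  assumes "f differentiable (at x)" "g differentiable (at x)"
  shows "dirderiv v (\<lambda>x. f x + g x) x = dirderiv v f x + dirderiv v g x"
  by (rule dirderiv_eq) (intro has_derivative_add has_derivative_dirderiv assms)

lemma dirderiv_mult:
  assumes "f differentiable (at x)" "g differentiable (at x)"
  shows "dirderiv v (\<lambda>x. f x * g x) x = f x * dirderiv v g x + dirderiv v f x * g x"
  by (rule dirderiv_eq) (intro has_derivative_mult has_derivative_dirderiv assms)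

lemma has_derivative_compose_real:
  assumes "(g has_real_derivative g') (at (f x))" "f differentiable (at x)"
  shows "((\<lambda>x. g (f x)) has_derivative (\<lambda>v. g' * dirderiv v f x)) (at x)"
  using has_derivative_compose[OF has_derivative_dirderiv[OF assms(2)], of g "\<lambda>t. g' * t"] assms(1)
  by (simp add: has_field_derivative_def)

lemma dirderiv_cong_open:
  assumes "open W" "x \<in> W" "\<And>y. y \<in> W \<Longrightarrow> f y = g y"
  shows "dirderiv v f x = dirderiv v g x"
proof -
  have "((\<lambda>t. x + t *\<^sub>R v) \<longlongrightarrow> x) (at 0)"
    by (auto intro!: tendsto_eq_intros)
  then have "\<forall>\<^sub>F t in at 0. x + t *\<^sub>R v \<in> W"
    using assms(1,2) by (rule topological_tendstoD)
  then have "\<forall>\<^sub>F t in nhds 0. x + t *\<^sub>R v \<in> W"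
    using assms(2) by (simp add: eventually_nhds_conv_at)
  then have "\<forall>\<^sub>F t in nhds 0. f (x + t *\<^sub>R v) = g (x + t *\<^sub>R v)"
    by (rule eventually_mono) (rule assms(3))
  then show ?thesis unfolding dirderiv_def by (intro deriv_cong_ev) auto
qed

lemma iter_dirderiv_zero_open:
  assumes "open W" "\<And>y. y \<in> W \<Longrightarrow> f y = 0" "x \<in> W"
  shows "iter_dirderiv vs f x = 0"
  using assms(3)
proof (induction vs arbitrary: x)
  case (Cons v vs)
  have "dirderiv v (iter_dirderiv vs f) x = dirderiv v (\<lambda>_. 0) x"
    by (rule dirderiv_cong_open[OF assms(1) Cons.prems]) (rule Cons.IH)
  also have "\<dots> = 0" by (rule dirderiv_eq) (rule has_derivative_const)
  finally show ?case by simp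
qed (simp add: assms)

lemma iter_dirderiv_append: "iter_dirderiv (us @ vs) f = iter_dirderiv us (iter_dirderiv vs f)"
  by (induction us) auto

lemma smooth_fun_iter: "smooth_fun f \<Longrightarrow> set vs \<subseteq> Basis \<Longrightarrow> smooth_fun (iter_dirderiv vs f)"
  unfolding smooth_fun_def by (metis iter_dirderiv_append set_append Un_subset_iff)

lemma smooth_fun_dirderiv: "smooth_fun f \<Longrightarrow> b \<in> Basis \<Longrightarrow> smooth_fun (dirderiv b f)"
  using smooth_fun_iter[of f "[b]"] by simp

lemma smooth_fun_differentiable: "smooth_fun f \<Longrightarrow> f differentiable (at x)"
  unfolding smooth_fun_def by (metis empty_iff iter_dirderiv.simps(1) list.set(1) subsetI)

lemma smooth_fun_continuous_on: "smooth_fun f \<Longrightarrow> continuous_on S f"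
  by (meson continuous_at_imp_continuous_on differentiable_imp_continuous_within
      smooth_fun_differentiable)

text \<open>An invariant class replaces the bookkeeping of iterated derivatives: a list of basis
  directions never leads out of \<open>P\<close>. All smoothness proofs below rest on this
  principle, mostly through \<open>alg_closure\<close>.\<close>

lemma smooth_fun_coinduct:
  assumes "P f" "\<And>g x. P g \<Longrightarrow> g differentiable (at x)"
    "\<And>g b. P g \<Longrightarrow> b \<in> Basis \<Longrightarrow> P (dirderiv b g)"
  shows "smooth_fun f"
proof -
  have "P (iter_dirderiv vs f)" if "set vs \<subseteq> Basis" for vs
    using that by (induction vs) (auto intro: assms)
  then show ?thesis unfolding smooth_fun_def using assms(2) by blast
qed

text \<open>Classes such as the functions \<open>inverse (f x)\<close> are not closed under
  differentiation, but their derivatives are polynomials in members of the class and smooth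
  functions. Passing to the generated algebra leaves only the derivatives of generators to be
  checked.\<close>

inductive alg_closure :: "(('a \<Rightarrow> real) \<Rightarrow> bool) \<Rightarrow> ('a \<Rightarrow> real) \<Rightarrow> bool" for P where
  base: "P f \<Longrightarrow> alg_closure P f"
| add: "alg_closure P f \<Longrightarrow> alg_closure P g \<Longrightarrow> alg_closure P (\<lambda>x. f x + g x)"
| mult: "alg_closure P f \<Longrightarrow> alg_closure P g \<Longrightarrow> alg_closure P (\<lambda>x. f x * g x)"

lemma smooth_fun_alg_closure:
  assumes f: "alg_closure P f" and d: "\<And>g x. P g \<Longrightarrow> g differentiable (at x)"
    and D: "\<And>g b. P g \<Longrightarrow> b \<in> Basis \<Longrightarrow> alg_closure P (dirderiv b g)"
  shows "smooth_fun f"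
proof (rule smooth_fun_coinduct[where P = "alg_closure P"])
  have diff: "g differentiable (at x)" if "alg_closure P g" for g x
    using that by induction (auto intro: d differentiable_add differentiable_mult)
  then show "g differentiable (at x)" if "alg_closure P g" for g x
    using that by blast
  show "alg_closure P (dirderiv b g)" if "alg_closure P g" "b \<in> Basis" for g b
    using that
  proof induction
    case (add f g)
    then have "dirderiv b (\<lambda>x. f x + g x) = (\<lambda>x. dirderiv b f x + dirderiv b g x)"
      by (auto intro: dirderiv_add diff)
    then show ?case using add by (auto intro: alg_closure.add)
  next
    case (mult f g)
    then have "dirderiv b (\<lambda>x. f x * g x) = (\<lambda>x. f x * dirderiv b g x + dirderiv b f x * g x)"
      by (auto intro: dirderiv_mult diff)
    then show ?case using mult by (auto intro: alg_closure.intros)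
  qed (rule D)
qed (rule f)

lemma smooth_fun_add: "smooth_fun f \<Longrightarrow> smooth_fun g \<Longrightarrow> smooth_fun (\<lambda>x. f x + g x)"
  by (rule smooth_fun_alg_closure[where P = smooth_fun])
    (auto intro: alg_closure.intros smooth_fun_differentiable smooth_fun_dirderiv)

lemma smooth_fun_mult: "smooth_fun f \<Longrightarrow> smooth_fun g \<Longrightarrow> smooth_fun (\<lambda>x. f x * g x)"
  by (rule smooth_fun_alg_closure[where P = smooth_fun])
    (auto intro: alg_closure.intros smooth_fun_differentiable smooth_fun_dirderiv)

lemma smooth_fun_const: "smooth_fun (\<lambda>_. c)"
proof (rule smooth_fun_coinduct[where P = "\<lambda>f. \<exists>c. f = (\<lambda>_. c)"])
  show "\<exists>c. dirderiv b g = (\<lambda>_. c)" if "\<exists>c. g = (\<lambda>_. c)" for b :: 'a and g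
    using that by (auto intro!: exI[of _ 0] dirderiv_eq)
qed auto

lemma smooth_fun_linear:
  assumes "bounded_linear f"
  shows "smooth_fun f"
proof (rule smooth_fun_alg_closure[where P = "\<lambda>g. g = f \<or> smooth_fun g"])
  have "dirderiv b f = (\<lambda>_. f b)" for b
    using assms by (auto intro!: dirderiv_eq bounded_linear_imp_has_derivative)
  then show "alg_closure (\<lambda>g. g = f \<or> smooth_fun g) (dirderiv b g)"
    if "g = f \<or> smooth_fun g" "b \<in> Basis" for g b
    using that by (auto intro!: alg_closure.base intro: smooth_fun_const smooth_fun_dirderiv)
  show "g differentiable (at x)" if "g = f \<or> smooth_fun g" for g x
    using that assms bounded_linear_imp_differentiable smooth_fun_differentiable by blast
qed (auto intro: alg_closure.base)

lemma smooth_fun_diff: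
  assumes "smooth_fun f" "smooth_fun g"
  shows "smooth_fun (\<lambda>x. f x - g x)"
  using smooth_fun_add[OF assms(1) smooth_fun_mult[OF smooth_fun_const[of "-1"] assms(2)]] by simp

lemma smooth_fun_prod:
  assumes "\<And>i. i \<in> I \<Longrightarrow> smooth_fun (f i)"
  shows "smooth_fun (\<lambda>x. \<Prod>i\<in>I. f i x)"
  using assms by (induction I rule: infinite_finite_induct) (auto intro: smooth_fun_const smooth_fun_mult)

lemma smooth_fun_polynomial: "real_polynomial_function p \<Longrightarrow> smooth_fun p"
  by (induction rule: real_polynomial_function.induct)
    (auto intro: smooth_fun_linear smooth_fun_const smooth_fun_add smooth_fun_mult)

text \<open>By the chain rule a partial derivative of \<open>g k (f x)\<close> is a linear
  combination of family members at \<open>f x\<close> times a smooth factor, so the family and the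
  smooth functions together generate a differentially closed algebra. It serves the shifted cosines
  and the functions \<open>flat k\<close>.\<close>

lemma smooth_fun_compose_family:
  fixes g :: "nat \<Rightarrow> real \<Rightarrow> real"
  assumes g: "\<And>k t. (g k has_real_derivative (\<Sum>i\<in>I k. c k i * g i t)) (at t)"
    and f: "smooth_fun f"
  shows "smooth_fun (\<lambda>x. g k (f x))"
proof -
  define P where "P h \<longleftrightarrow> (\<exists>k. h = (\<lambda>x. g k (f x))) \<or> smooth_fun h" for h
  note d = has_derivative_compose_real[OF g smooth_fun_differentiable[OF f]]
  have sm: "alg_closure P h" if "smooth_fun h" for h
    using that by (simp add: P_def alg_closure.base)
  have sum: "alg_closure P (\<lambda>x. \<Sum>i\<in>J. c k i * g i (f x))" for J k
  proof (induction J rule: infinite_finite_induct)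
    case (insert i J)
    have "alg_closure P (\<lambda>x. c k i * g i (f x))"
      by (intro alg_closure.mult[of P "\<lambda>_. c k i"] sm smooth_fun_const alg_closure.base)
        (auto simp: P_def)
    then show ?case using insert by (simp add: alg_closure.add)
  qed (auto intro: sm smooth_fun_const)
  show ?thesis
  proof (rule smooth_fun_alg_closure[where P = P])
    show "alg_closure P (dirderiv b h)" if "P h" "b \<in> Basis" for h b
      using that(1) unfolding P_def
    proof
      assume "\<exists>k. h = (\<lambda>x. g k (f x))"
      then obtain k where "h = (\<lambda>x. g k (f x))" by blast
      then have "dirderiv b h = (\<lambda>x. (\<Sum>i\<in>I k. c k i * g i (f x)) * dirderiv b f x)"
        using dirderiv_eq[OF d] by auto
      then show "alg_closure (\<lambda>h. (\<exists>k. h = (\<lambda>x. g k (f x))) \<or> smooth_fun h) (dirderiv b h)"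
        using alg_closure.mult[OF sum sm[OF smooth_fun_dirderiv[OF f that(2)]]]
        by (simp add: P_def[abs_def])
    qed (auto intro!: alg_closure.base smooth_fun_dirderiv that)
    show "h differentiable (at x)" if "P h" for h x
      using that d unfolding P_def differentiable_def
      by (metis smooth_fun_differentiable differentiable_def)
  qed (auto simp: P_def intro!: alg_closure.base)
qed

lemma smooth_fun_cos:
  assumes "smooth_fun f"
  shows "smooth_fun (\<lambda>x. cos (f x))"
proof -
  have "((\<lambda>t. cos (t + real k * pi / 2)) has_real_derivative
      (\<Sum>i\<in>{Suc k}. 1 * cos (t + real i * pi / 2))) (at t)" for k t
    by (auto intro!: derivative_eq_intros simp: cos_add sin_add algebra_simps add_divide_distrib)
  from smooth_fun_compose_family[where g="\<lambda>k t. cos (t + real k * pi / 2)", OF this assms, of 0]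
  show ?thesis by simp
qed

lemma smooth_fun_inverse:
  assumes f: "smooth_fun f" and nz: "\<And>x. f x \<noteq> 0"
  shows "smooth_fun (\<lambda>x. inverse (f x))"
proof -
  define P where "P h \<longleftrightarrow> h = (\<lambda>x. inverse (f x)) \<or> smooth_fun h" for h
  have d: "((\<lambda>x. inverse (f x)) has_derivative (\<lambda>v. - (inverse (f x) * dirderiv v f x * inverse (f x)))) (at x)"
    for x by (intro Deriv.has_derivative_inverse nz has_derivative_dirderiv smooth_fun_differentiable f)
  show ?thesis
  proof (rule smooth_fun_alg_closure[where P = P])
    show "alg_closure P (dirderiv b h)" if "P h" "b \<in> Basis" for h b
    proof (cases "smooth_fun h")
      case False
      with that have "h = (\<lambda>x. inverse (f x))" by (simp add: P_def)
      then have eq: "dirderiv b h = (\<lambda>x. (-1 * dirderiv b f x) * (inverse (f x) * inverse (f x)))"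
        using dirderiv_eq[OF d] by (auto simp: algebra_simps)
      show ?thesis unfolding eq
        by (intro alg_closure.mult alg_closure.base)
          (auto simp: P_def intro: that smooth_fun_const smooth_fun_dirderiv f)
    qed (auto simp: P_def intro!: alg_closure.base smooth_fun_dirderiv that)
    show "h differentiable (at x)" if "P h" for h x
      using that d unfolding P_def differentiable_def
      by (metis smooth_fun_differentiable differentiable_def)
  qed (auto simp: P_def intro!: alg_closure.base)
qed

section \<open>Cutoff functions\<close>

text \<open>\<open>flat 0\<close> is the classical function exp(-1/t) extended by zero. The index
  supplies the powers of 1/t that differentiation creates, so that the whole family is closed under
  it.\<close>

definition flat :: "nat \<Rightarrow> real \<Rightarrow> real" where
  "flat k t = (if t > 0 then exp (- 1 / t) / t ^ k else 0)"

text \<open>The single term of order k + 2 of the exponential series bounds exp(1/t) from below. Two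
  orders beyond k are taken so that a factor \<open>t\<^sup>2\<close> remains, which makes the
  difference quotient at 0 tend to 0.\<close>

lemma abs_flat_le: "\<bar>flat k t\<bar> \<le> fact (k + 2) * t\<^sup>2"
proof (cases "t > 0")
  case True
  define n where "n = k + 2"
  have "(1 / t) ^ n / fact n \<le> (\<Sum>n. (1 / t) ^ n / fact n)"
    using sum_le_suminf[of "\<lambda>n. (1 / t) ^ n / fact n" "{n}"] summable_exp_generic[of "1 / t"] True
    by (simp add: divide_inverse mult.commute)
  also have "\<dots> = exp (1 / t)"
    by (simp add: exp_def divide_inverse mult.commute)
  finally have "exp (- (1 / t)) \<le> fact n * t ^ n"
    using True by (simp add: exp_minus field_simps)
  then have "exp (- 1 / t) / t ^ k \<le> fact n * t ^ n / t ^ k"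
    using True by (intro divide_right_mono) auto
  also have "\<dots> = fact n * t\<^sup>2"
    using True by (simp add: power_add power2_eq_square n_def del: fact_Suc)
  finally show ?thesis using True by (simp add: flat_def n_def del: fact_Suc)
qed (simp add: flat_def)

lemma has_real_derivative_flat:
  "(flat k has_real_derivative flat (k + 2) t - real k * flat (k + 1) t) (at t)"
proof -
  consider "t > 0" | "t < 0" | "t = 0" by linarith
  then show ?thesis
  proof cases
    case 1
    have "((\<lambda>t. exp (- 1 / t) / t ^ k) has_real_derivative
        flat (k + 2) t - real k * flat (k + 1) t) (at t)"
    proof -
      have "real k * t ^ (k - Suc 0) = real k * t ^ k / t"
        using 1 by (cases k) auto
      then show ?thesis
        using 1 by (auto intro!: derivative_eq_intros simp: flat_def divide_simps power2_eq_square)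
          (simp add: algebra_simps)
    qed
    then show ?thesis
      by (rule has_field_derivative_transform_within_open[where S="{0<..}"])
        (use 1 in \<open>auto simp: flat_def\<close>)
  next
    case 2
    have "((\<lambda>_. 0) has_real_derivative flat (k + 2) t - real k * flat (k + 1) t) (at t)"
      using 2 by (auto simp: flat_def)
    then show ?thesis
      by (rule has_field_derivative_transform_within_open[where S="{..<0}"])
        (use 2 in \<open>auto simp: flat_def\<close>)
  next
    case 3
    have "((\<lambda>h. flat k h / h) \<longlongrightarrow> 0) (at 0)"
    proof (rule Lim_null_comparison)
      show "\<forall>\<^sub>F h in at 0. norm (flat k h / h) \<le> fact (k + 2) * \<bar>h\<bar>"
      proof (rule always_eventually, rule allI)
        fix h
        have "\<bar>flat k h\<bar> / \<bar>h\<bar> \<le> fact (k + 2) * (\<bar>h\<bar> * \<bar>h\<bar>) / \<bar>h\<bar>"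
          using abs_flat_le[of k h] by (intro divide_right_mono) (auto simp: power2_eq_square)
        also have "\<dots> = fact (k + 2) * \<bar>h\<bar>" by (simp del: fact_Suc abs_mult_self_eq)
        finally show "norm (flat k h / h) \<le> fact (k + 2) * \<bar>h\<bar>" by (simp del: fact_Suc)
      qed
      show "((\<lambda>h. fact (k + 2) * \<bar>h\<bar>) \<longlongrightarrow> (0 :: real)) (at 0)"
        by (auto intro!: tendsto_eq_intros)
    qed
    moreover have "flat n 0 = 0" for n by (simp add: flat_def)
    ultimately show ?thesis using 3 by (simp add: DERIV_def)
  qed
qed

lemma smooth_fun_flat:
  assumes "smooth_fun f"
  shows "smooth_fun (\<lambda>x. flat k (f x))"
proof (rule smooth_fun_compose_family[OF _ assms])
  show "(flat k has_real_derivative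
      (\<Sum>i\<in>{k + 1, k + 2}. (if i = k + 2 then 1 else - real k) * flat i t)) (at t)" for k t
    using has_real_derivative_flat[of k t] by simp
qed

text \<open>The variable enters through its square because the absolute value is not smooth at 0.
  For 0 < p < q this is an even bump with plateau |t| \<le> p and support in |t| \<le> q.\<close>

definition cutoff :: "real \<Rightarrow> real \<Rightarrow> real \<Rightarrow> real" where
  "cutoff p q t = flat 0 (q\<^sup>2 - t\<^sup>2) * inverse (flat 0 (q\<^sup>2 - t\<^sup>2) + flat 0 (t\<^sup>2 - p\<^sup>2))"

lemma flat_nonneg: "0 \<le> flat 0 t" and flat_pos: "0 < t \<Longrightarrow> 0 < flat 0 t"
  and flat_eq_0: "t \<le> 0 \<Longrightarrow> flat 0 t = 0"
  by (auto simp: flat_def)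

lemma cutoff_denom_pos:
  assumes "0 < p" "p < q"
  shows "0 < flat 0 (q\<^sup>2 - t\<^sup>2) + flat 0 (t\<^sup>2 - p\<^sup>2)"
proof -
  have "p\<^sup>2 < q\<^sup>2" using assms by (intro power_strict_mono) auto
  then consider "t\<^sup>2 < q\<^sup>2" | "p\<^sup>2 < t\<^sup>2" by linarith
  then show ?thesis
    by cases (simp_all add: add_pos_nonneg add_nonneg_pos flat_pos flat_nonneg)
qed

lemma smooth_fun_cutoff:
  assumes "0 < p" "p < q" "smooth_fun f"
  shows "smooth_fun (\<lambda>x. cutoff p q (f x))"
proof -
  have sq: "smooth_fun (\<lambda>x. (f x)\<^sup>2)"
    unfolding power2_eq_square by (intro smooth_fun_mult assms)
  have "flat 0 (q\<^sup>2 - t\<^sup>2) + flat 0 (t\<^sup>2 - p\<^sup>2) \<noteq> 0" for t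
    using cutoff_denom_pos[OF assms(1,2), of t] by simp
  then show ?thesis unfolding cutoff_def
    by (intro smooth_fun_mult smooth_fun_inverse smooth_fun_add smooth_fun_flat
        smooth_fun_diff smooth_fun_const sq)
qed

lemma cutoff_range:
  assumes "0 < p" "p < q"
  shows "0 \<le> cutoff p q t" "cutoff p q t \<le> 1"
  using cutoff_denom_pos[OF assms, of t] flat_nonneg[of "q\<^sup>2 - t\<^sup>2"] flat_nonneg[of "t\<^sup>2 - p\<^sup>2"]
  by (auto simp: cutoff_def field_simps)

lemma cutoff_eq_1:
  assumes "0 < p" "p < q" "\<bar>t\<bar> \<le> p"
  shows "cutoff p q t = 1"
proof -
  have "t\<^sup>2 \<le> p\<^sup>2" using assms by (metis abs_le_square_iff abs_of_pos)
  then show ?thesis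
    using cutoff_denom_pos[OF assms(1,2), of t] by (simp add: cutoff_def flat_eq_0)
qed

lemma cutoff_eq_0:
  assumes "0 < q" "q \<le> \<bar>t\<bar>"
  shows "cutoff p q t = 0"
proof -
  have "q\<^sup>2 \<le> t\<^sup>2" using assms by (metis abs_le_square_iff abs_of_pos)
  then show ?thesis by (simp add: cutoff_def flat_eq_0)
qed

definition cube_cutoff :: "real \<Rightarrow> real \<Rightarrow> real^'m \<Rightarrow> real" where
  "cube_cutoff p q x = (\<Prod>i\<in>UNIV. cutoff p q (x $ i))"

lemma smooth_fun_cube_cutoff:
  assumes "0 < p" "p < q" "\<And>i. smooth_fun (\<lambda>x. f x $ i)"
  shows "smooth_fun (\<lambda>x. cube_cutoff p q (f x))"
  unfolding cube_cutoff_def by (intro smooth_fun_prod smooth_fun_cutoff assms)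

lemma cube_cutoff_range:
  assumes "0 < p" "p < q"
  shows "0 \<le> cube_cutoff p q x" "cube_cutoff p q x \<le> 1"
  unfolding cube_cutoff_def using cutoff_range[OF assms] by (auto intro!: prod_nonneg prod_le_1)

lemma cube_cutoff_eq_1: "0 < p \<Longrightarrow> p < q \<Longrightarrow> (\<And>i. \<bar>x $ i\<bar> \<le> p) \<Longrightarrow> cube_cutoff p q x = 1"
  by (simp add: cube_cutoff_def cutoff_eq_1)

lemma cube_cutoff_eq_0: "0 < q \<Longrightarrow> q \<le> \<bar>x $ i\<bar> \<Longrightarrow> cube_cutoff p q x = 0"
  using cutoff_eq_0 by (force simp: cube_cutoff_def)

lemma smooth_fun_component: "smooth_fun (\<lambda>x. x $ i)"
  by (rule smooth_fun_linear) (rule bounded_linear_vec_nth)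

lemma smooth_map_vecI: "(\<And>i. smooth_fun (\<lambda>x. f x $ i)) \<Longrightarrow> smooth_map f"
  by (auto simp: smooth_map_def Basis_vec_def inner_axis)

section \<open>Smooth inverses of shears\<close>

text \<open>On each line parallel to \<open>u\<close> the map is a perturbation of the identity by a
  bounded 1/2-Lipschitz function: the Lipschitz bound gives injectivity and the intermediate value
  theorem on [-M, M] gives surjectivity. Smoothness of the inverse follows because its derivative is
  a smooth expression evaluated at the inverse itself.\<close>

lemma shear_inverse:
  fixes \<Psi> :: "'a::euclidean_space \<Rightarrow> real"
  assumes u: "u \<in> Basis" and \<Psi>: "smooth_fun \<Psi>" and half: "\<And>x. \<bar>dirderiv u \<Psi> x\<bar> \<le> 1/2"
    and bound: "\<And>x. \<bar>\<Psi> x\<bar> \<le> M"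
  obtains G where "smooth_map G" "\<And>x. G (x + \<Psi> x *\<^sub>R u) = x" "\<And>y. G y + \<Psi> (G y) *\<^sub>R u = y"
proof -
  define F where "F = (\<lambda>x. x + \<Psi> x *\<^sub>R u)"
  note D = has_derivative_dirderiv[OF smooth_fun_differentiable]
  have linD: "dirderiv (v - c *\<^sub>R w) f x = dirderiv v f x - c * dirderiv w f x"
    if "smooth_fun f" for f :: "'a \<Rightarrow> real" and v w c x
    using linear_diff[OF has_derivative_linear[OF D[OF that]], of v "c *\<^sub>R w" x]
      linear_scale[OF has_derivative_linear[OF D[OF that]], of c w x]
    by simp
  have line: "((\<lambda>s. \<Psi> (x + s *\<^sub>R u)) has_real_derivative dirderiv u \<Psi> (x + s *\<^sub>R u)) (at s)" for x s
  proof -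
    have "((\<lambda>s. \<Psi> (x + s *\<^sub>R u)) has_derivative (\<lambda>h. dirderiv (h *\<^sub>R u) \<Psi> (x + s *\<^sub>R u))) (at s)"
      by (rule has_derivative_compose[OF _ D[OF \<Psi>], of "\<lambda>s. x + s *\<^sub>R u"])
        (auto intro!: derivative_eq_intros)
    moreover have "dirderiv (h *\<^sub>R u) \<Psi> y = dirderiv u \<Psi> y * h" for h y
      using linear_scale[OF has_derivative_linear[OF D[OF \<Psi>]], of h u y] by simp
    ultimately show ?thesis by (simp add: has_field_derivative_def)
  qed
  have lip: "\<bar>\<Psi> (x + s *\<^sub>R u) - \<Psi> x\<bar> \<le> 1/2 * \<bar>s\<bar>" for x s
    using field_differentiable_bound[of UNIV "\<lambda>s. \<Psi> (x + s *\<^sub>R u)" "\<lambda>s. dirderiv u \<Psi> (x + s *\<^sub>R u)" "1/2" s 0]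
      line half by auto
  have inj: "inj F"
  proof (rule injI)
    fix x y assume "F x = F y"
    then have y: "y = x + (\<Psi> x - \<Psi> y) *\<^sub>R u" by (simp add: F_def algebra_simps)
    have "\<bar>- (\<Psi> x - \<Psi> y)\<bar> \<le> 1/2 * \<bar>\<Psi> x - \<Psi> y\<bar>"
      using lip[of x "\<Psi> x - \<Psi> y"] y by simp
    then have "\<Psi> x = \<Psi> y" unfolding abs_minus_cancel by simp
    then show "x = y" using y by simp
  qed
  have "\<exists>x. F x = y" for y
  proof -
    have "0 \<le> M" using bound[of 0] by linarith
    moreover have "continuous_on {- M..M} (\<lambda>s. s + \<Psi> (y + s *\<^sub>R u))"
      by (intro continuous_on_add continuous_on_id continuous_at_imp_continuous_on ballI
          DERIV_isCont[OF line])
    moreover have "- M + \<Psi> (y + (- M) *\<^sub>R u) \<le> 0" "0 \<le> M + \<Psi> (y + M *\<^sub>R u)"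
      using bound[of "y + (- M) *\<^sub>R u"] bound[of "y + M *\<^sub>R u"] by linarith+
    ultimately obtain s where "s + \<Psi> (y + s *\<^sub>R u) = 0"
      using IVT'[of "\<lambda>s. s + \<Psi> (y + s *\<^sub>R u)" "- M" 0 M] by auto
    then have "F (y + s *\<^sub>R u) = y"
      by (simp add: F_def flip: scaleR_add_left)
    then show ?thesis ..
  qed
  then have surj: "surj F" unfolding surj_def by metis
  define G where "G = inv F"
  have GF: "G (F x) = x" and FG: "F (G y) = y" for x y
    using inj surj by (simp_all add: G_def surj_f_inv_f)
  \<comment> \<open>With L the derivative of \<open>\<Psi>\<close> at x, the rank-one perturbation v
    + L(v) u of the identity has inverse w - (L(w) / (1 + L(u))) u; \<open>\<kappa>\<close> is the
    scalar 1 / (1 + L(u)).\<close>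
  define \<kappa> where "\<kappa> = (\<lambda>x. inverse (1 + dirderiv u \<Psi> x))"
  have pos: "1 + dirderiv u \<Psi> x \<noteq> 0" for x
    using half[of x] by (auto simp: abs_le_iff)
  have \<kappa>: "smooth_fun \<kappa>"
    unfolding \<kappa>_def by (intro smooth_fun_inverse smooth_fun_add smooth_fun_const smooth_fun_dirderiv \<Psi> u pos)
  have FD: "(F has_derivative (\<lambda>v. v + dirderiv v \<Psi> x *\<^sub>R u)) (at x)" for x
    unfolding F_def by (intro derivative_intros D \<Psi>)
  have GD: "(G has_derivative (\<lambda>w. w - (dirderiv w \<Psi> x * \<kappa> x) *\<^sub>R u)) (at (F x))" for x
  proof (rule has_derivative_inverse_strong[of UNIV x F, OF _ _ _ _ FD])
    show "continuous_on UNIV F"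
      using FD by (meson continuous_at_imp_continuous_on has_derivative_continuous)
    show "(\<lambda>v. v + dirderiv v \<Psi> x *\<^sub>R u) \<circ> (\<lambda>w. w - (dirderiv w \<Psi> x * \<kappa> x) *\<^sub>R u) = id"
    proof
      fix w
      have "- (dirderiv w \<Psi> x * \<kappa> x) + (dirderiv w \<Psi> x - (dirderiv w \<Psi> x * \<kappa> x) * dirderiv u \<Psi> x) = 0"
        using pos[of x] by (simp add: \<kappa>_def field_simps)
      then show "((\<lambda>v. v + dirderiv v \<Psi> x *\<^sub>R u) \<circ> (\<lambda>w. w - (dirderiv w \<Psi> x * \<kappa> x) *\<^sub>R u)) w = id w"
        by (simp add: linD[OF \<Psi>] flip: scaleR_add_left scaleR_minus_left add.assoc)
    qed
  qed (auto simp: GF)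
  have comp: "((\<lambda>y. f (G y)) has_derivative
      (\<lambda>w. dirderiv w f (G y) - dirderiv w \<Psi> (G y) * \<kappa> (G y) * dirderiv u f (G y))) (at y)"
    if "smooth_fun f" for f y
    using has_derivative_compose[OF GD[of "G y", unfolded FG] D[OF that]] by (simp add: linD that)
  \<comment> \<open>Partial derivatives of \<open>f \<circ> G\<close> are again smooth functions composed with \<open>G\<close>.\<close>
  have smooth: "smooth_fun (\<lambda>y. f (G y))" if f: "smooth_fun f" for f
  proof (rule smooth_fun_coinduct[where P = "\<lambda>h. \<exists>f. smooth_fun f \<and> h = (\<lambda>y. f (G y))"])
    show "\<exists>f'. smooth_fun f' \<and> (\<lambda>y. f (G y)) = (\<lambda>y. f' (G y))"
      using f by blast
    show "h differentiable (at x)" if "\<exists>f. smooth_fun f \<and> h = (\<lambda>y. f (G y))" for h x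
      using that comp unfolding differentiable_def by blast
    show "\<exists>f. smooth_fun f \<and> dirderiv b h = (\<lambda>y. f (G y))"
      if h: "\<exists>f. smooth_fun f \<and> h = (\<lambda>y. f (G y))" and b: "b \<in> Basis" for h b
    proof -
      obtain f where f: "smooth_fun f" "h = (\<lambda>y. f (G y))" using h by blast
      have "dirderiv b h = (\<lambda>y. (\<lambda>x. dirderiv b f x - dirderiv b \<Psi> x * \<kappa> x * dirderiv u f x) (G y))"
        using dirderiv_eq[OF comp[OF f(1)]] f(2) by auto
      moreover have "smooth_fun (\<lambda>x. dirderiv b f x - dirderiv b \<Psi> x * \<kappa> x * dirderiv u f x)"
        by (intro smooth_fun_diff smooth_fun_mult smooth_fun_dirderiv f \<Psi> \<kappa> u b)
      ultimately show ?thesis by blast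
    qed
  qed
  have "smooth_map G"
    unfolding smooth_map_def by (intro ballI smooth[of "\<lambda>x. x \<bullet> _"] smooth_fun_linear bounded_linear_inner_left)
  then show thesis using that[of G] GF FG by (simp add: F_def)
qed

section \<open>Rapidly oscillating functions\<close>

text \<open>A derivative along \<open>u\<close> hits either the amplitude or the phase, and the
  latter yields a factor c/\<delta> and a quarter turn; the other basis directions see only the
  amplitude. So the power of 1/\<delta> is at most the number of occurrences of \<open>u\<close>.
  The amplitudes \<open>A\<close> are chosen before \<delta>, which later makes the estimates
  uniform in it.\<close>

lemma iter_dirderiv_oscillation:
  fixes g :: "'a::euclidean_space \<Rightarrow> real"
  assumes g: "smooth_fun g" and u: "u \<in> Basis" and "set vs \<subseteq> Basis"
  shows "\<exists>A. (\<forall>q. smooth_fun (A q)) \<and>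
    (count_list vs u = length vs \<longrightarrow> A (length vs) = (\<lambda>x. c ^ length vs * g x)) \<and>
    (\<forall>\<delta>>0. iter_dirderiv vs (\<lambda>x. g x * cos (c * (x \<bullet> u) / \<delta> + \<theta>)) =
      (\<lambda>x. \<Sum>q\<le>count_list vs u. (1 / \<delta>) ^ q * (A q x * cos (c * (x \<bullet> u) / \<delta> + \<theta> + real q * pi / 2))))"
  using assms(3)
proof (induction vs)
  case Nil
  then show ?case using g by (intro exI[of _ "\<lambda>_. g"]) auto
next
  case (Cons v vs)
  define n where "n = count_list vs u"
  define \<phi> where "\<phi> = (\<lambda>\<delta> q x. c * (x \<bullet> u) / \<delta> + \<theta> + real q * pi / 2)"
  from Cons obtain A where A: "\<And>q. smooth_fun (A q)"
    and top: "n = length vs \<Longrightarrow> A n = (\<lambda>x. c ^ n * g x)"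
    and eq: "\<And>\<delta>. \<delta> > 0 \<Longrightarrow> iter_dirderiv vs (\<lambda>x. g x * cos (c * (x \<bullet> u) / \<delta> + \<theta>)) =
      (\<lambda>x. \<Sum>q\<le>n. (1 / \<delta>) ^ q * (A q x * cos (\<phi> \<delta> q x)))"
    by (auto simp: n_def \<phi>_def)
  have v: "v \<in> Basis" using Cons.prems by simp
  have step: "dirderiv v (iter_dirderiv vs (\<lambda>x. g x * cos (c * (x \<bullet> u) / \<delta> + \<theta>))) x =
      (\<Sum>q\<le>n. (1 / \<delta>) ^ q * (dirderiv v (A q) x * cos (\<phi> \<delta> q x))) +
      (\<Sum>q\<le>n. (1 / \<delta>) ^ Suc q * (c * (v \<bullet> u) * A q x * cos (\<phi> \<delta> (Suc q) x)))"
    if "\<delta> > 0" for \<delta> x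
  proof -
    have D: "((\<lambda>x. A q x * cos (\<phi> \<delta> q x)) has_derivative
       (\<lambda>w. dirderiv w (A q) x * cos (\<phi> \<delta> q x) + (1 / \<delta>) * (c * (w \<bullet> u) * A q x * cos (\<phi> \<delta> (Suc q) x)))) (at x)"
      for q
    proof -
      have "cos (\<phi> \<delta> (Suc q) x) = - sin (\<phi> \<delta> q x)"
        by (simp add: \<phi>_def cos_add sin_add add_divide_distrib distrib_right)
      then show ?thesis using that unfolding \<phi>_def
        by (auto intro!: derivative_eq_intros has_derivative_dirderiv smooth_fun_differentiable A
            simp: field_simps)
    qed
    show ?thesis unfolding eq[OF that]
      by (rule trans, rule dirderiv_eq, rule has_derivative_sum, rule has_derivative_mult_right, rule D)
        (simp add: algebra_simps sum.distrib)
  qed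
  show ?case
  proof (cases "v = u")
    case False
    then have "v \<bullet> u = 0" using u v by (simp add: inner_Basis)
    moreover have "count_list (v # vs) u = n" "n \<noteq> length (v # vs)"
      using False count_le_length[of vs u] by (auto simp: n_def)
    ultimately show ?thesis
      using step by (intro exI[of _ "\<lambda>q. dirderiv v (A q)"])
        (auto simp: \<phi>_def intro: smooth_fun_dirderiv A v)
  next
    case True
    \<comment> \<open>The new coefficient of order q collects the amplitude derivative of the old
      q-th term and the phase derivative of the old (q-1)-th term. The conditionals remove the
      missing contributions at q = n + 1 and at q = 0, where \<open>q - 1\<close> is
      truncated.\<close>
    define B where "B q = (\<lambda>x. (if q \<le> n then 1 else 0) * dirderiv v (A q) x + (if q = 0 then 0 else c) * A (q - 1) x)" for q
    have c: "count_list (v # vs) u = Suc n" and uu: "v \<bullet> u = 1" using True u by (auto simp: n_def inner_Basis)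
    have "(\<Sum>q\<le>Suc n. (1 / \<delta>) ^ q * (B q x * cos (\<phi> \<delta> q x))) =
        (\<Sum>q\<le>n. (1 / \<delta>) ^ q * (dirderiv v (A q) x * cos (\<phi> \<delta> q x))) +
        (\<Sum>q\<le>n. (1 / \<delta>) ^ Suc q * (c * (v \<bullet> u) * A q x * cos (\<phi> \<delta> (Suc q) x)))" (is "?l = ?a + ?b") for \<delta> x
    proof -
      have "?l = (\<Sum>q\<le>Suc n. (1 / \<delta>) ^ q * ((if q \<le> n then 1 else 0) * dirderiv v (A q) x * cos (\<phi> \<delta> q x))) +
         (\<Sum>q\<le>Suc n. (1 / \<delta>) ^ q * ((if q = 0 then 0 else c) * A (q - 1) x * cos (\<phi> \<delta> q x)))"
        unfolding B_def by (simp only: distrib_left distrib_right sum.distrib)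
      also have "(\<Sum>q\<le>Suc n. (1 / \<delta>) ^ q * ((if q \<le> n then 1 else 0) * dirderiv v (A q) x * cos (\<phi> \<delta> q x))) = ?a"
        by simp
      also have "(\<Sum>q\<le>Suc n. (1 / \<delta>) ^ q * ((if q = 0 then 0 else c) * A (q - 1) x * cos (\<phi> \<delta> q x))) = ?b"
        by (subst sum.atMost_Suc_shift) (simp add: uu)
      finally show ?thesis .
    qed
    moreover have "smooth_fun (B q)" for q
      unfolding B_def by (intro smooth_fun_add smooth_fun_mult smooth_fun_const smooth_fun_dirderiv A v)
    moreover have "B (Suc n) = (\<lambda>x. c ^ Suc n * g x)" if "n = length vs"
      unfolding B_def using top[OF that] by (auto simp: mult.assoc)
    ultimately show ?thesis unfolding c
      using step by (intro exI[of _ B]) (auto simp: \<phi>_def)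
  qed
qed

text \<open>The factor \<delta>^r turns every term of order q < r in 1/\<delta> into one of size at
  most a constant times \<delta>. If all r derivatives are along \<open>u\<close>, the term q = r
  survives undamped, with known amplitude, and is subtracted.\<close>

lemma oscillation_bound:
  fixes g :: "'a::euclidean_space \<Rightarrow> real"
  assumes g: "smooth_fun g" and u: "u \<in> Basis" and vs: "set vs \<subseteq> Basis" and K: "compact K"
  obtains C where
    "\<And>\<delta>::real. \<And>x. count_list vs u < r \<Longrightarrow> 0 < \<delta> \<Longrightarrow> \<delta> \<le> 1 \<Longrightarrow> x \<in> K \<Longrightarrow>
      \<bar>\<delta> ^ r * iter_dirderiv vs (\<lambda>x. g x * cos (c * (x \<bullet> u) / \<delta> + \<theta>)) x\<bar> \<le> C * \<delta>"
    "\<And>\<delta>::real. \<And>x. count_list vs u = r \<Longrightarrow> length vs = r \<Longrightarrow> 0 < \<delta> \<Longrightarrow> \<delta> \<le> 1 \<Longrightarrow> x \<in> K \<Longrightarrow>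
      \<bar>\<delta> ^ r * iter_dirderiv vs (\<lambda>x. g x * cos (c * (x \<bullet> u) / \<delta> + \<theta>)) x -
        c ^ r * g x * cos (c * (x \<bullet> u) / \<delta> + \<theta> + real r * pi / 2)\<bar> \<le> C * \<delta>"
proof -
  define n where "n = count_list vs u"
  from iter_dirderiv_oscillation[OF g u vs, of c \<theta>] obtain A where A: "\<And>q. smooth_fun (A q)"
    and top: "n = length vs \<Longrightarrow> A n = (\<lambda>x. c ^ n * g x)"
    and eq: "\<And>\<delta>. \<delta> > 0 \<Longrightarrow> iter_dirderiv vs (\<lambda>x. g x * cos (c * (x \<bullet> u) / \<delta> + \<theta>)) =
      (\<lambda>x. \<Sum>q\<le>n. (1 / \<delta>) ^ q * (A q x * cos (c * (x \<bullet> u) / \<delta> + \<theta> + real q * pi / 2)))"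
    by (auto simp: n_def)
  have "\<exists>B. \<forall>x\<in>K. \<bar>A q x\<bar> \<le> B" for q
    using compact_imp_bounded[OF compact_continuous_image[OF smooth_fun_continuous_on[OF A] K]]
    by (auto simp: bounded_iff)
  then obtain B where B: "\<And>q x. x \<in> K \<Longrightarrow> \<bar>A q x\<bar> \<le> B q" by metis
  have bnd: "\<bar>\<delta> ^ r * ((1 / \<delta>) ^ q * (A q x * cos y))\<bar> \<le> \<bar>B q\<bar> * \<delta>"
    if "q < r" "0 < \<delta>" "\<delta> \<le> 1" "x \<in> K" for q x y and \<delta> :: real
  proof -
    have "\<delta> ^ r * (1 / \<delta>) ^ q = \<delta> ^ (r - q)"
      using that by (simp add: power_diff power_divide)
    then have "\<bar>\<delta> ^ r * ((1 / \<delta>) ^ q * (A q x * cos y))\<bar> = \<delta> ^ (r - q) * (\<bar>A q x\<bar> * \<bar>cos y\<bar>)"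
      using that by (simp add: abs_mult flip: mult.assoc)
    also have "\<dots> \<le> \<delta> * (\<bar>B q\<bar> * 1)"
      using that power_decreasing[of 1 "r - q" \<delta>] order_trans[OF B[OF that(4), of q] abs_ge_self]
      by (intro mult_mono) auto
    finally show ?thesis by (simp add: mult.commute)
  qed
  define C where "C = (\<Sum>q\<le>n. \<bar>B q\<bar>)"
  have sums: "\<bar>\<Sum>q\<in>Q. \<delta> ^ r * ((1 / \<delta>) ^ q * (A q x * cos (y q)))\<bar> \<le> C * \<delta>"
    if "Q \<subseteq> {..n}" "\<And>q. q \<in> Q \<Longrightarrow> q < r" "0 < \<delta>" "\<delta> \<le> 1" "x \<in> K" for Q x y and \<delta> :: real
  proof -
    have "\<bar>\<Sum>q\<in>Q. \<delta> ^ r * ((1 / \<delta>) ^ q * (A q x * cos (y q)))\<bar> \<le> (\<Sum>q\<in>Q. \<bar>B q\<bar> * \<delta>)"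
      by (rule order_trans[OF sum_abs]) (intro sum_mono bnd that)
    also have "\<dots> \<le> (\<Sum>q\<le>n. \<bar>B q\<bar> * \<delta>)"
      using that by (intro sum_mono2) auto
    finally show ?thesis by (simp add: C_def sum_distrib_right)
  qed
  show thesis
  proof (rule that[of C])
    fix \<delta> :: real and x assume "count_list vs u < r" "0 < \<delta>" "\<delta> \<le> 1" "x \<in> K"
    then show "\<bar>\<delta> ^ r * iter_dirderiv vs (\<lambda>x. g x * cos (c * (x \<bullet> u) / \<delta> + \<theta>)) x\<bar> \<le> C * \<delta>"
      by (simp add: eq sum_distrib_left del: times_divide_eq_left) (rule sums, auto simp: n_def)
  next
    fix \<delta> :: real and x assume *: "count_list vs u = r" "length vs = r" "0 < \<delta>" "\<delta> \<le> 1" "x \<in> K"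
    have "{..n} = insert r {..<r}" using * by (auto simp: n_def)
    then have "\<delta> ^ r * iter_dirderiv vs (\<lambda>x. g x * cos (c * (x \<bullet> u) / \<delta> + \<theta>)) x -
        c ^ r * g x * cos (c * (x \<bullet> u) / \<delta> + \<theta> + real r * pi / 2) =
      (\<Sum>q<r. \<delta> ^ r * ((1 / \<delta>) ^ q * (A q x * cos (c * (x \<bullet> u) / \<delta> + \<theta> + real q * pi / 2))))"
      using * top by (simp add: eq sum_distrib_left distrib_left power_divide n_def)
    then show "\<bar>\<delta> ^ r * iter_dirderiv vs (\<lambda>x. g x * cos (c * (x \<bullet> u) / \<delta> + \<theta>)) x -
        c ^ r * g x * cos (c * (x \<bullet> u) / \<delta> + \<theta> + real r * pi / 2)\<bar> \<le> C * \<delta>"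
      using * by (simp only:) (rule sums, auto simp: n_def)
  qed
qed

section \<open>Linearity of iterated derivatives, and multi-indices as lists of directions\<close>

lemma iter_dirderiv_add:
  assumes "smooth_fun f" "smooth_fun g" "set vs \<subseteq> Basis"
  shows "iter_dirderiv vs (\<lambda>x. f x + g x) = (\<lambda>x. iter_dirderiv vs f x + iter_dirderiv vs g x)"
  using assms(3)
proof (induction vs)
  case (Cons v vs)
  have "dirderiv v (\<lambda>x. iter_dirderiv vs f x + iter_dirderiv vs g x) x =
      dirderiv v (iter_dirderiv vs f) x + dirderiv v (iter_dirderiv vs g) x" for x
    using Cons.prems
    by (intro dirderiv_add smooth_fun_differentiable smooth_fun_iter assms) simp_all
  then show ?case using Cons by simp
qed simp

lemma iter_dirderiv_cmult:
  assumes "smooth_fun f" "set vs \<subseteq> Basis"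
  shows "iter_dirderiv vs (\<lambda>x. c * f x) = (\<lambda>x. c * iter_dirderiv vs f x)"
  using assms(2)
proof (induction vs)
  case (Cons v vs)
  have "dirderiv v (\<lambda>x. c * iter_dirderiv vs f x) = (\<lambda>x. c * dirderiv v (iter_dirderiv vs f) x)"
    using Cons.prems
    by (intro ext dirderiv_eq has_derivative_mult_right has_derivative_dirderiv
        smooth_fun_differentiable smooth_fun_iter assms) simp
  then show ?case using Cons by simp
qed simp

definition mi_list :: "('m::{finite,wellorder} \<Rightarrow> nat) \<Rightarrow> (real, 'm) vec list" where
  "mi_list \<alpha> = concat (map (\<lambda>i. replicate (\<alpha> i) (axis i 1)) (sorted_list_of_set UNIV))"

lemma pderiv_mi_eq: "pderiv_mi \<alpha> = iter_dirderiv (mi_list \<alpha>)"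
  by (simp add: pderiv_mi_def mi_list_def fun_eq_iff)

lemma set_mi_list: "set (mi_list \<alpha>) \<subseteq> Basis"
  by (auto simp: mi_list_def Basis_vec_def)

lemma length_mi_list: "length (mi_list \<alpha>) = mi_deg \<alpha>"
proof -
  have "distinct xs \<Longrightarrow> length (concat (map (\<lambda>i. replicate (\<alpha> i) (axis i (1::real)))  xs)) = (\<Sum>i\<in>set xs. \<alpha> i)"
    for xs by (induction xs) auto
  from this[of "sorted_list_of_set UNIV"] show ?thesis by (simp add: mi_list_def mi_deg_def)
qed

lemma count_mi_list: "count_list (mi_list \<alpha>) (axis i 1) = \<alpha> i"
proof -
  have rep: "count_list (replicate n y) z = (if y = z then n else 0)" for n and y z :: "(real, 'a) vec"
    by (induction n) auto
  have "distinct xs \<Longrightarrow> count_list (concat (map (\<lambda>i. replicate (\<alpha> i) (axis i (1::real)))  xs)) (axis i 1) =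
      (if i \<in> set xs then \<alpha> i else 0)"
    for xs by (induction xs) (auto simp: rep axis_eq_axis)
  from this[of "sorted_list_of_set UNIV"] show ?thesis by (simp add: mi_list_def)
qed

lemma finite_jet_coords: "finite (jet_coords r)"
proof (rule finite_subset)
  show "jet_coords r \<subseteq> (UNIV :: 'a::finite set) \<rightarrow>\<^sub>E {..r}"
  proof
    fix \<alpha> :: "'a \<Rightarrow> nat" assume "\<alpha> \<in> jet_coords r"
    then have "\<alpha> i \<le> r" for i
      using member_le_sum[of i UNIV \<alpha>] by (simp add: jet_coords_def mi_deg_def)
    then show "\<alpha> \<in> UNIV \<rightarrow>\<^sub>E {..r}" by auto
  qed
qed (auto intro: finite_PiE)

lemma pure1_jet_coords: "pure1 r \<in> jet_coords r"
  by (simp add: jet_coords_def mi_deg_def pure1_def)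

lemma jet_coords_eq: "jet_coords r = insert (pure1 r) (perp_coords r)"
  using pure1_jet_coords by (auto simp: jet_coords_def perp_coords_def)

text \<open>An exponent r in direction \<open>e1\<close> exhausts the degree and leaves only the
  pure derivative. Every other jet coordinate therefore costs fewer than r powers of 1/\<delta> and
  is damped by \<delta>^r.\<close>

lemma perp_coords_e1_less:
  assumes "\<alpha> \<in> perp_coords r"
  shows "\<alpha> e1 < r"
proof (rule ccontr)
  assume "\<not> \<alpha> e1 < r"
  moreover have "\<alpha> e1 + (\<Sum>i\<in>UNIV - {e1}. \<alpha> i) \<le> r"
    using assms by (simp add: perp_coords_def mi_deg_def sum.remove[of UNIV e1])
  ultimately have "\<alpha> e1 = r" "(\<Sum>i\<in>UNIV - {e1}. \<alpha> i) = 0" by linarith+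
  then have "\<alpha> = pure1 r" by (auto simp: pure1_def)
  then show False using assms by (simp add: perp_coords_def)
qed

section \<open>The cube\<close>

lemma compact_cube: "compact (cube :: (real^'a) set)"
  and frontier_cube: "frontier cube = {x \<in> cube :: (real^'a) set. \<exists>i. \<bar>x $ i\<bar> = 1}"
proof -
  have eq: "cube = cbox (- 1) (1 :: real^'a)"
    by (auto simp: cube_def mem_box_cart abs_le_iff minus_le_iff)
  show "compact (cube :: (real^'a) set)" by (simp add: eq)
  have "box (- 1) (1 :: real^'a) = {x. \<forall>i. \<bar>x $ i\<bar> < 1}"
    by (auto simp: mem_box_cart abs_less_iff minus_less_iff)
  then show "frontier cube = {x \<in> cube :: (real^'a) set. \<exists>i. \<bar>x $ i\<bar> = 1}"
    unfolding eq frontier_cbox unfolding eq[symmetric]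
    by (auto simp: cube_def) (metis less_eq_real_def, metis less_irrefl)
qed

text \<open>The part of the cube outside \<open>U\<close> is compact and misses the frontier, so
  each |x_i| has a maximum below 1 on it. As there are finitely many coordinates, one margin serves
  them all.\<close>

lemma frontier_cube_margin:
  fixes U :: "(real^'m) set"
  assumes "open U" "frontier cube \<subseteq> U"
  obtains c where "0 < c" "c < 1" "\<And>x i. x \<in> cube \<Longrightarrow> c \<le> \<bar>x $ i\<bar> \<Longrightarrow> x \<in> U"
proof -
  define K where "K = cube - U"
  have K: "compact K" unfolding K_def using compact_cube assms(1) by (rule compact_diff)
  have "\<exists>c. 0 < c \<and> c < 1 \<and> (\<forall>x\<in>K. \<bar>x $ i\<bar> < c)" for i
  proof (cases "K = {}")
    case True
    then show ?thesis by (intro exI[of _ "1/2"]) auto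
  next
    case False
    have "continuous_on K (\<lambda>x. \<bar>x $ i\<bar>)" by (intro continuous_intros)
    from continuous_attains_sup[OF K False this] obtain y
      where y: "y \<in> K" "\<And>x. x \<in> K \<Longrightarrow> \<bar>x $ i\<bar> \<le> \<bar>y $ i\<bar>" by blast
    have "\<bar>y $ i\<bar> < 1"
      using y(1) assms(2) unfolding K_def frontier_cube by (auto simp: cube_def less_le)
    then show ?thesis
      using y(2) by (intro exI[of _ "(1 + \<bar>y $ i\<bar>) / 2"]) force
  qed
  then obtain c where c: "\<And>i. 0 < c i" "\<And>i. c i < 1" "\<And>x i. x \<in> K \<Longrightarrow> \<bar>x $ i\<bar> < c i"
    by metis
  have le: "c i \<le> Max (range c)" for i by simp
  show thesis
  proof (rule that[of "Max (range c)"])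
    show "0 < Max (range c)" using less_le_trans[OF c(1) le] .
    show "Max (range c) < 1" using c(2) by auto
    show "x \<in> U" if "x \<in> cube" "Max (range c) \<le> \<bar>x $ i\<bar>" for x i
      using c(3)[of x i] le[of i] that by (force simp: K_def)
  qed
qed

section \<open>Jets of rapidly oscillating maps\<close>

text \<open>The two amplitudes belong to the first and second harmonic in x_1/\<delta>. They are
  given before \<delta> is chosen, so they may involve the amplitude of the shear.\<close>

lemma oscillation_jet:
  fixes g1 g2 :: "'n::finite \<Rightarrow> (real, 'm::{finite,wellorder}) vec \<Rightarrow> real"
  assumes g1: "\<And>j. smooth_fun (g1 j)" and g2: "\<And>j. smooth_fun (g2 j)" and "\<eta> > 0"
  obtains \<delta> and h :: "(real, 'm) vec \<Rightarrow> (real, 'n) vec" where "0 < \<delta>" "smooth_map h"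
    "\<And>x \<alpha> j. x \<in> cube \<Longrightarrow> \<alpha> \<in> perp_coords r \<Longrightarrow> \<bar>jet r h x \<alpha> j\<bar> < \<eta>"
    "\<And>x j. x \<in> cube \<Longrightarrow> \<bar>jet r h x (pure1 r) j -
       (g1 j x * cos (x $ e1 / \<delta>) + 2 ^ r * g2 j x * cos (2 * (x $ e1 / \<delta>)))\<bar> < \<eta>"
    "\<And>W x \<alpha> j. open W \<Longrightarrow> \<forall>y\<in>W. \<forall>j. g1 j y = 0 \<and> g2 j y = 0 \<Longrightarrow> x \<in> W \<Longrightarrow>
       jet r h x \<alpha> j = 0"
proof -
  define u where "u = (axis e1 1 :: (real, 'm) vec)"
  have u: "u \<in> Basis" and ip: "x \<bullet> u = x $ e1" for x
    by (auto simp: u_def Basis_vec_def inner_axis)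
  have count: "count_list (mi_list \<alpha>) u = \<alpha> e1" for \<alpha> :: "'m \<Rightarrow> nat"
    unfolding u_def by (rule count_mi_list)
  \<comment> \<open>This phase cancels the r quarter turns of the pure derivative, which thus ends
    at an unshifted cosine.\<close>
  define \<theta> where "\<theta> = - (real r * pi / 2)"
  define osc where "osc c g \<delta> = (\<lambda>x. g x * cos (c * (x \<bullet> u) / \<delta> + \<theta>))"
    for c \<delta> :: real and g :: "(real, 'm) vec \<Rightarrow> real"
  have osc: "smooth_fun (osc c g \<delta>)" if "smooth_fun g" for c g \<delta>
    unfolding osc_def divide_inverse
    by (intro smooth_fun_mult smooth_fun_cos smooth_fun_add smooth_fun_const that
        smooth_fun_linear bounded_linear_inner_left)
  define Q where "Q c g \<alpha> C \<longleftrightarrow> (\<forall>\<delta> x. 0 < \<delta> \<longrightarrow> \<delta> \<le> 1 \<longrightarrow> x \<in> cube \<longrightarrow>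
      (\<alpha> \<in> perp_coords r \<longrightarrow> \<bar>\<delta> ^ r * pderiv_mi \<alpha> (osc c g \<delta>) x\<bar> \<le> C * \<delta>) \<and>
      (\<alpha> = pure1 r \<longrightarrow>
        \<bar>\<delta> ^ r * pderiv_mi \<alpha> (osc c g \<delta>) x - c ^ r * g x * cos (c * (x $ e1 / \<delta>))\<bar> \<le> C * \<delta>))"
    for c :: real and g and \<alpha> :: "'m \<Rightarrow> nat" and C :: real
  have Q: "\<exists>C. Q c g \<alpha> C" if g: "smooth_fun g" for c g \<alpha>
  proof -
    obtain C where C:
      "\<And>\<delta> x. count_list (mi_list \<alpha>) u < r \<Longrightarrow> 0 < \<delta> \<Longrightarrow> \<delta> \<le> 1 \<Longrightarrow> x \<in> cube \<Longrightarrow>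
        \<bar>\<delta> ^ r * iter_dirderiv (mi_list \<alpha>) (\<lambda>x. g x * cos (c * (x \<bullet> u) / \<delta> + \<theta>)) x\<bar> \<le> C * \<delta>"
      "\<And>\<delta> x. count_list (mi_list \<alpha>) u = r \<Longrightarrow> length (mi_list \<alpha>) = r \<Longrightarrow>
        0 < \<delta> \<Longrightarrow> \<delta> \<le> 1 \<Longrightarrow> x \<in> cube \<Longrightarrow>
        \<bar>\<delta> ^ r * iter_dirderiv (mi_list \<alpha>) (\<lambda>x. g x * cos (c * (x \<bullet> u) / \<delta> + \<theta>)) x -
          c ^ r * g x * cos (c * (x \<bullet> u) / \<delta> + \<theta> + real r * pi / 2)\<bar> \<le> C * \<delta>"
      by (rule oscillation_bound[OF g u set_mi_list[of \<alpha>] compact_cube, of r c \<theta>], rule that)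
    have "mi_deg (pure1 r :: 'm \<Rightarrow> nat) = r" "pure1 r e1 = r"
      by (simp_all add: pure1_def mi_deg_def)
    then show ?thesis
      unfolding Q_def using C perp_coords_e1_less[of \<alpha> r]
      by (intro exI[of _ C] allI impI conjI)
        (simp_all add: pderiv_mi_eq osc_def count length_mi_list \<theta>_def ip)
  qed
  have "\<exists>C. \<forall>\<alpha> j. Q 1 (g1 j) \<alpha> (C \<alpha> j)" by (intro choice allI Q g1)
  then obtain C1 where C1: "\<And>\<alpha> j. Q 1 (g1 j) \<alpha> (C1 \<alpha> j)" by blast
  have "\<exists>C. \<forall>\<alpha> j. Q 2 (g2 j) \<alpha> (C \<alpha> j)" by (intro choice allI Q g2)
  then obtain C2 where C2: "\<And>\<alpha> j. Q 2 (g2 j) \<alpha> (C2 \<alpha> j)" by blast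
  \<comment> \<open>Only finitely many pairs of a multi-index and a component occur, so one
    constant, and hence one \<delta>, serves all of them.\<close>
  define D where "D = (\<Sum>(\<alpha>, j)\<in>jet_coords r \<times> UNIV. \<bar>C1 \<alpha> j\<bar> + \<bar>C2 \<alpha> j\<bar>)"
  have CD: "C1 \<alpha> j + C2 \<alpha> j \<le> D" if "\<alpha> \<in> jet_coords r" for \<alpha> j
  proof -
    have "\<bar>C1 \<alpha> j\<bar> + \<bar>C2 \<alpha> j\<bar> \<le> D"
      unfolding D_def using that finite_jet_coords[of r]
        member_le_sum[of "(\<alpha>, j)" "jet_coords r \<times> UNIV" "\<lambda>(\<alpha>, j). \<bar>C1 \<alpha> j\<bar> + \<bar>C2 \<alpha> j\<bar>"]
      by fastforce
    then show ?thesis by linarith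
  qed
  have D0: "0 \<le> D" unfolding D_def by (intro sum_nonneg) auto
  \<comment> \<open>The summand 1 keeps the quotient meaningful when D = 0 and makes D \<delta> <
    \<eta> strict.\<close>
  define \<delta> where "\<delta> = min 1 (\<eta> / (D + 1))"
  have \<delta>: "0 < \<delta>" "\<delta> \<le> 1" using D0 \<open>\<eta> > 0\<close> by (auto simp: \<delta>_def)
  have "(D + 1) * \<delta> \<le> (D + 1) * (\<eta> / (D + 1))"
    using D0 by (intro mult_left_mono) (auto simp: \<delta>_def)
  moreover have "(D + 1) * (\<eta> / (D + 1)) = \<eta>" using D0 by simp
  ultimately have D\<delta>: "D * \<delta> < \<eta>" using \<delta> D0 by (simp add: algebra_simps)
  have small: "C1 \<alpha> j * \<delta> + C2 \<alpha> j * \<delta> < \<eta>" if "\<alpha> \<in> jet_coords r" for \<alpha> j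
    using mult_right_mono[OF CD[OF that, of j], of \<delta>] \<delta> D\<delta> by (simp add: distrib_right)
  define h :: "(real, 'm) vec \<Rightarrow> (real, 'n) vec" where
    "h x = (\<chi> j. \<delta> ^ r * (osc 1 (g1 j) \<delta> x + osc 2 (g2 j) \<delta> x))" for x
  have smooth_comp: "smooth_fun (\<lambda>x. osc 1 (g1 j) \<delta> x + osc 2 (g2 j) \<delta> x)" for j
    by (intro smooth_fun_add osc g1 g2)
  have "pderiv_mi \<alpha> (\<lambda>x. \<delta> ^ r * (osc 1 (g1 j) \<delta> x + osc 2 (g2 j) \<delta> x)) x =
      \<delta> ^ r * pderiv_mi \<alpha> (osc 1 (g1 j) \<delta>) x + \<delta> ^ r * pderiv_mi \<alpha> (osc 2 (g2 j) \<delta>) x" for \<alpha> x j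
    unfolding pderiv_mi_eq iter_dirderiv_cmult[OF smooth_comp set_mi_list]
    by (simp add: iter_dirderiv_add[OF osc[OF g1] osc[OF g2] set_mi_list] distrib_left)
  then have jet: "jet r h x \<alpha> j =
      \<delta> ^ r * pderiv_mi \<alpha> (osc 1 (g1 j) \<delta>) x + \<delta> ^ r * pderiv_mi \<alpha> (osc 2 (g2 j) \<delta>) x"
    if "\<alpha> \<in> jet_coords r" for \<alpha> x j
    using that by (simp add: jet_def h_def jet_coords_def)
  show thesis
  proof (rule that[of \<delta> h])
    show "0 < \<delta>" by (fact \<delta>)
    show "smooth_map h"
      by (rule smooth_map_vecI) (auto simp: h_def intro!: smooth_fun_mult[OF smooth_fun_const] smooth_comp)
    show "\<bar>jet r h x \<alpha> j\<bar> < \<eta>" if x: "x \<in> cube" and \<alpha>: "\<alpha> \<in> perp_coords r" for x \<alpha> j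
    proof -
      have "\<alpha> \<in> jet_coords r" using \<alpha> by (simp add: jet_coords_eq)
      with C1[of j \<alpha>, unfolded Q_def, rule_format, OF \<delta> x] C2[of j \<alpha>, unfolded Q_def, rule_format, OF \<delta> x] \<alpha> small[of \<alpha> j] jet[of \<alpha> x j] show ?thesis
        by linarith
    qed
    show "\<bar>jet r h x (pure1 r) j -
       (g1 j x * cos (x $ e1 / \<delta>) + 2 ^ r * g2 j x * cos (2 * (x $ e1 / \<delta>)))\<bar> < \<eta>"
      if x: "x \<in> cube" for x j
    proof -
      have "\<bar>\<delta> ^ r * pderiv_mi (pure1 r) (osc 1 (g1 j) \<delta>) x - g1 j x * cos (x $ e1 / \<delta>)\<bar> \<le> C1 (pure1 r) j * \<delta>"
        "\<bar>\<delta> ^ r * pderiv_mi (pure1 r) (osc 2 (g2 j) \<delta>) x - 2 ^ r * g2 j x * cos (2 * (x $ e1 / \<delta>))\<bar> \<le> C2 (pure1 r) j * \<delta>"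
        using C1[of j "pure1 r", unfolded Q_def, rule_format, OF \<delta> x] C2[of j "pure1 r", unfolded Q_def, rule_format, OF \<delta> x] by auto
      with small[OF pure1_jet_coords, of j] jet[OF pure1_jet_coords, of x j] show ?thesis by linarith
    qed
    show "jet r h x \<alpha> j = 0" if "open W" "\<forall>y\<in>W. \<forall>j. g1 j y = 0 \<and> g2 j y = 0" "x \<in> W" for W x \<alpha> j
      using iter_dirderiv_zero_open[OF that(1) _ that(3), of "\<lambda>y. h y $ j"] that(2)
      by (simp add: jet_def pderiv_mi_eq h_def osc_def)
  qed
qed

section \<open>Global bounds for the cube cutoff, and smooth approximation vanishing near the
  boundary\<close>

lemma cube_cutoff_eq_0_outside:
  assumes "0 < q" "q \<le> 1" "x \<notin> cube"
  shows "cube_cutoff p q x = 0"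
proof -
  obtain i where "1 < \<bar>x $ i\<bar>" using assms(3) by (auto simp: cube_def not_le)
  then show ?thesis using assms(1,2) by (intro cube_cutoff_eq_0[of q x i]) auto
qed

text \<open>Compactness bounds the derivative on the cube, and on the open complement the cutoff
  vanishes identically. A bound on the whole space is wanted because the shears are inverted
  globally.\<close>

lemma dirderiv_cube_cutoff_bounded:
  fixes u :: "real^'m"
  assumes "0 < p" "p < q" "q \<le> 1" "u \<in> Basis"
  obtains B where "0 \<le> B" "\<And>x. \<bar>dirderiv u (cube_cutoff p q) x\<bar> \<le> B"
proof -
  have sm: "smooth_fun (cube_cutoff p q :: real^'m \<Rightarrow> real)"
    by (intro smooth_fun_cube_cutoff assms smooth_fun_component)
  have "compact (dirderiv u (cube_cutoff p q) ` cube)"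
    by (intro compact_continuous_image smooth_fun_continuous_on smooth_fun_dirderiv sm assms compact_cube)
  then have "\<exists>B. \<forall>x\<in>cube. \<bar>dirderiv u (cube_cutoff p q) x\<bar> \<le> B"
    by (auto dest!: compact_imp_bounded simp: bounded_iff)
  then obtain B where B: "\<And>x. x \<in> cube \<Longrightarrow> \<bar>dirderiv u (cube_cutoff p q) x\<bar> \<le> B"
    by blast
  have "dirderiv u (cube_cutoff p q) x = 0" if "x \<notin> cube" for x
  proof -
    have "open (- (cube :: (real^'m) set))" by (intro open_Compl compact_imp_closed compact_cube)
    moreover have "0 < q" using assms by simp
    ultimately show ?thesis
      using iter_dirderiv_zero_open[of "- cube" "cube_cutoff p q" x "[u]"] that \<open>q \<le> 1\<close>
      by (simp add: cube_cutoff_eq_0_outside)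
  qed
  then have "\<bar>dirderiv u (cube_cutoff p q) x\<bar> \<le> \<bar>B\<bar>" for x
    using B[of x] by (cases "x \<in> cube") auto
  then show thesis using that[of "\<bar>B\<bar>"] by simp
qed

text \<open>A Weierstrass polynomial is multiplied by a cutoff. No accuracy is lost: where the
  cutoff differs from 1 the target is 0, and a factor in [0, 1] only shrinks a polynomial value
  already below \<open>e\<close>.\<close>

lemma approx_cutoff_polynomial:
  assumes s: "continuous_on cube s" and c: "0 < p" "p < q" and "0 < e"
    and zero: "\<And>x i. x \<in> cube \<Longrightarrow> p \<le> \<bar>x $ i\<bar> \<Longrightarrow> s x = 0"
  obtains f where "smooth_fun f" "\<And>x. x \<in> cube \<Longrightarrow> \<bar>f x - s x\<bar> < e"
    "\<And>x i. q \<le> \<bar>x $ i\<bar> \<Longrightarrow> f x = 0"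
proof -
  obtain P where P: "real_polynomial_function P" "\<And>x. x \<in> cube \<Longrightarrow> \<bar>s x - P x\<bar> < e"
    using Stone_Weierstrass_real_polynomial_function[OF compact_cube s \<open>0 < e\<close>] by blast
  show thesis
  proof (rule that[of "\<lambda>x. cube_cutoff p q x * P x"])
    show "smooth_fun (\<lambda>x. cube_cutoff p q x * P x)"
      by (intro smooth_fun_mult[OF _ smooth_fun_polynomial[OF P(1)]] smooth_fun_cube_cutoff
          smooth_fun_component c)
    show "\<bar>cube_cutoff p q x * P x - s x\<bar> < e" if x: "x \<in> cube" for x
    proof (cases "\<forall>i. \<bar>x $ i\<bar> \<le> p")
      case True
      then show ?thesis using P(2)[OF x] c by (simp add: cube_cutoff_eq_1 abs_minus_commute)
    next
      case False
      then have "s x = 0" using zero[OF x] by (auto simp: not_le dest: less_imp_le)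
      moreover have "\<bar>cube_cutoff p q x * P x\<bar> \<le> 1 * \<bar>P x\<bar>"
        unfolding abs_mult using cube_cutoff_range[OF c, of x] by (intro mult_right_mono) auto
      ultimately show ?thesis using P(2)[OF x] by simp
    qed
    show "cube_cutoff p q x * P x = 0" if "q \<le> \<bar>x $ i\<bar>" for x i
      using cube_cutoff_eq_0[OF _ that] c by simp
  qed
qed

section \<open>Shears of the cube\<close>

text \<open>The shear is a bijection of the whole space that fixes every point outside the cube. A
  cube point sent outside would share its image with a fixed exterior point, contradicting
  injectivity; the same argument applies to the inverse.\<close>

lemma shear_diffeo_cube:
  fixes \<Psi> :: "real^'m \<Rightarrow> real"
  assumes "u \<in> Basis" and \<Psi>: "smooth_fun \<Psi>" and "\<And>x. \<bar>dirderiv u \<Psi> x\<bar> \<le> 1/2"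
    and "\<And>x. \<bar>\<Psi> x\<bar> \<le> M" and out: "\<And>x. x \<notin> cube \<Longrightarrow> \<Psi> x = 0"
  shows "diffeo_cube (\<lambda>x. x + \<Psi> x *\<^sub>R u)"
proof -
  obtain G where G: "smooth_map G" "\<And>x. G (x + \<Psi> x *\<^sub>R u) = x" "\<And>y. G y + \<Psi> (G y) *\<^sub>R u = y"
    using shear_inverse[OF assms(1-4)] by blast
  have "smooth_map (\<lambda>x. x + \<Psi> x *\<^sub>R u)"
    by (rule smooth_map_vecI)
      (simp, intro smooth_fun_add smooth_fun_mult \<Psi> smooth_fun_const smooth_fun_component)
  moreover have "x + \<Psi> x *\<^sub>R u \<in> cube" if "x \<in> cube" for x
  proof (rule ccontr)
    assume *: "x + \<Psi> x *\<^sub>R u \<notin> cube"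
    with G(2)[of "x + \<Psi> x *\<^sub>R u"] have "x + \<Psi> x *\<^sub>R u = G (x + \<Psi> x *\<^sub>R u)"
      by (simp add: out)
    then show False using G(2)[of x] that * by auto
  qed
  moreover have "G y \<in> cube" if "y \<in> cube" for y
    using G(3)[of y] out[of "G y"] that by (cases "G y \<in> cube") auto
  ultimately show ?thesis unfolding diffeo_cube_def using G by (auto simp: image_iff) metis
qed

text \<open>For \<open>l \<noteq> e1\<close> the differential changes only coordinate
  \<open>l\<close>, so it keeps the first coordinate; equality of the image needs the rank-one
  perturbation of the identity to be invertible, which is the condition \<open>nz\<close>.\<close>

lemma shear_image_hypV:
  fixes \<Psi> :: "(real, 'm::{finite,wellorder}) vec \<Rightarrow> real"
  assumes \<Psi>: "smooth_fun \<Psi>" and nz: "dirderiv (axis l 1) \<Psi> x \<noteq> - 1"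
    and l: "l = e1 \<Longrightarrow> \<Psi> = (\<lambda>_. 0)"
  shows "frechet_derivative (\<lambda>x. x + \<Psi> x *\<^sub>R axis l 1) (at x) ` hypV = hypV"
proof -
  define L where "L = (\<lambda>v. dirderiv v \<Psi> x)"
  have D: "(\<Psi> has_derivative L) (at x)"
    unfolding L_def by (rule has_derivative_dirderiv[OF smooth_fun_differentiable[OF \<Psi>]])
  have "((\<lambda>x. x + \<Psi> x *\<^sub>R axis l 1) has_derivative (\<lambda>v. v + L v *\<^sub>R axis l 1)) (at x)"
    by (intro derivative_intros D)
  then have F: "frechet_derivative (\<lambda>x. x + \<Psi> x *\<^sub>R axis l 1) (at x) = (\<lambda>v. v + L v *\<^sub>R axis l 1)"
    by (rule frechet_derivative_at[symmetric])
  show ?thesis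
  proof (cases "l = e1")
    case True
    have "L v = 0" for v
      unfolding L_def l[OF True] by (intro dirderiv_eq has_derivative_const)
    then show ?thesis by (simp add: F)
  next
    case False
    have "w \<in> (\<lambda>v. v + L v *\<^sub>R axis l 1) ` hypV" if "w \<in> hypV" for w
    proof (rule image_eqI)
      \<comment> \<open>The value solves \<open>c = L w - c * L (axis l 1)\<close>, the condition
        for the preimage to map to \<open>w\<close>.\<close>
      define c where "c = L w / (1 + L (axis l 1))"
      show "w - c *\<^sub>R axis l 1 \<in> hypV" using that False by (simp add: hypV_def axis_def)
      have "L (w - c *\<^sub>R axis l 1) = L w - c * L (axis l 1)"
        using has_derivative_linear[OF D] by (simp add: linear_diff linear_scale)
      also have "\<dots> = c"
        using nz by (simp add: c_def L_def field_simps)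
      finally show "w = w - c *\<^sub>R axis l 1 + L (w - c *\<^sub>R axis l 1) *\<^sub>R axis l 1" by simp
    qed
    moreover have "v + L v *\<^sub>R axis l 1 \<in> hypV" if "v \<in> hypV" for v
      using that False by (simp add: hypV_def axis_def)
    ultimately show ?thesis unfolding F by blast
  qed
qed

text \<open>Since k < m, this rank is at least k, so the last coordinate vanishes on
  \<open>subcube k\<close>.\<close>

lemma crank_Max: "crank (Max UNIV :: 'm::{finite,wellorder}) = CARD('m) - 1"
proof -
  have "{j. j < (Max UNIV :: 'm)} = UNIV - {Max UNIV}"
    by (auto simp: less_le)
  then show ?thesis by (simp add: crank_def card_Diff_singleton)
qed

section \<open>The wiggled subcube and its holonomic section\<close>

theorem mainTheorem14:
  fixes \<sigma> :: "(real, 'm::{finite,wellorder}) vec \<Rightarrow> ('m \<Rightarrow> nat) \<Rightarrow> 'n::finite \<Rightarrow> real"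
    and k r :: nat and \<epsilon> :: real
  assumes "k < CARD('m)"
    and "\<forall>\<alpha>\<in>jet_coords r. \<forall>j. continuous_on cube (\<lambda>x. \<sigma> x \<alpha> j)"
    and "\<exists>U. open U \<and> frontier cube \<subseteq> U \<and>
           (\<forall>x\<in>U \<inter> cube. \<forall>\<alpha>\<in>jet_coords r. \<forall>j. \<sigma> x \<alpha> j = 0)"
    and "\<forall>x\<in>cube. \<forall>\<alpha>\<in>perp_coords r. \<forall>j. \<sigma> x \<alpha> j = 0"
    and "\<epsilon> > 0"
  shows "\<exists>(F :: real \<Rightarrow> (real, 'm) vec \<Rightarrow> (real, 'm) vec) (h :: (real, 'm) vec \<Rightarrow> (real, 'n) vec).
     isotopy F \<and> smooth_map h \<and>
     (\<exists>U. open U \<and> F 1 ` subcube k \<subseteq> U \<and>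
        (\<forall>x\<in>U \<inter> cube. \<forall>\<alpha>\<in>jet_coords r. \<forall>j. \<bar>jet r h x \<alpha> j - \<sigma> x \<alpha> j\<bar> < \<epsilon>)) \<and>
     (\<forall>x\<in>cube. \<forall>\<alpha>\<in>perp_coords r. \<forall>j. \<bar>jet r h x \<alpha> j\<bar> < \<epsilon>) \<and>
     (\<forall>t\<in>{0..1}. \<forall>x\<in>cube. dist (F t x) x < \<epsilon>) \<and>
     (\<exists>U. open U \<and> frontier cube \<subseteq> U \<and>
        (\<forall>t\<in>{0..1}. \<forall>x\<in>U \<inter> cube. F t x = x) \<and>
        (\<forall>x\<in>U \<inter> cube. \<forall>\<alpha>\<in>jet_coords r. \<forall>j. jet r h x \<alpha> j = 0)) \<and>
     (\<forall>t\<in>{0..1}. \<forall>x\<in>cube. frechet_derivative (F t) (at x) ` hypV = hypV)"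
proof -
  define s where "s = (\<lambda>j x. \<sigma> x (pure1 r) j)"
  have s: "continuous_on cube (s j)" for j
    using bspec[OF assms(2) pure1_jet_coords] by (simp add: s_def)
  obtain U0 where U0: "open U0" "frontier cube \<subseteq> U0"
    "\<And>x j. x \<in> U0 \<inter> cube \<Longrightarrow> s j x = 0"
    using assms(3) pure1_jet_coords[of r] unfolding s_def by blast
  obtain c1 where c1: "0 < c1" "c1 < 1" "\<And>x i. x \<in> cube \<Longrightarrow> c1 \<le> \<bar>x $ i\<bar> \<Longrightarrow> x \<in> U0"
    using frontier_cube_margin[OF U0(1,2)] by blast
  \<comment> \<open>Three nested radii: the section vanishes beyond \<open>c1\<close>, its smooth
    approximation beyond \<open>c2\<close>, and the shear cutoff is 1 up to \<open>c2\<close> and 0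
    beyond \<open>c3\<close>. Thus the shear has full amplitude wherever the approximation is
    nonzero.\<close>
  obtain c2 where c2: "c1 < c2" "c2 < 1" using dense[OF c1(2)] by blast
  obtain c3 where c3: "c2 < c3" "c3 < 1" using dense[OF c2(2)] by blast
  have pos: "0 < c2" "0 < c3" using c1 c2 c3 by auto
  have "\<exists>f. smooth_fun f \<and> (\<forall>x\<in>cube. \<bar>f x - s j x\<bar> < \<epsilon> / 2) \<and> (\<forall>x. (\<exists>i. c2 \<le> \<bar>x $ i\<bar>) \<longrightarrow> f x = 0)" for j
  proof -
    have zero: "s j x = 0" if "x \<in> cube" "c1 \<le> \<bar>x $ i\<bar>" for x i
      using U0(3) c1(3)[OF that] that by blast
    have "0 < \<epsilon> / 2" using \<open>\<epsilon> > 0\<close> by simp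
    then show ?thesis
      by (rule approx_cutoff_polynomial[OF s[of j] c1(1) c2(1)]) (use zero in blast)+
  qed
  then obtain st where st: "\<And>j. smooth_fun (st j)" "\<And>j x. x \<in> cube \<Longrightarrow> \<bar>st j x - s j x\<bar> < \<epsilon> / 2"
    "\<And>j x i. c2 \<le> \<bar>x $ i\<bar> \<Longrightarrow> st j x = 0"
    by metis
  define l where "l = (Max UNIV :: 'm)"
  define \<psi> :: "(real, 'm) vec \<Rightarrow> real" where "\<psi> = cube_cutoff c2 c3"
  have \<psi>: "smooth_fun \<psi>"
    unfolding \<psi>_def by (intro smooth_fun_cube_cutoff pos c3 smooth_fun_component)
  have \<psi>_le: "\<bar>\<psi> x\<bar> \<le> 1" for x
    using cube_cutoff_range[OF pos(1) c3(1), of x] by (simp add: \<psi>_def)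
  have el: "axis l 1 \<in> (Basis :: (real, 'm) vec set)" by (auto simp: Basis_vec_def)
  obtain B where B: "0 \<le> B" "\<And>x. \<bar>dirderiv (axis l 1) \<psi> x\<bar> \<le> B"
    using dirderiv_cube_cutoff_bounded[OF pos(1) c3(1) less_imp_le[OF c3(2)] el] by (auto simp: \<psi>_def)
  \<comment> \<open>The first bound controls the displacement, the second gives
    \<open>a * B \<le> 1 / 2\<close> for the derivative of the shear along
    \<open>axis l 1\<close>.\<close>
  define a where "a = min (\<epsilon> / 2) (1 / (2 * (B + 1)))"
  have a: "0 < a" "a < \<epsilon>" using B(1) \<open>\<epsilon> > 0\<close> by (auto simp: a_def)
  have "a * B \<le> 1 / (2 * (B + 1)) * (B + 1)"
    using B(1) a(1) by (intro mult_mono) (auto simp: a_def)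
  also have "\<dots> = 1 / 2" using B(1) by (simp add: field_simps)
  finally have aB: "a * B \<le> 1 / 2" .
  \<comment> \<open>If \<^term>\<open>l = e1\<close>, then the cube is one-dimensional and \<^term>\<open>k = 0\<close>: no wiggling is needed.\<close>
  define b where "b = (if l = e1 then 0 else a)"
  have b: "\<bar>b\<bar> \<le> a" using a by (simp add: b_def)
  \<comment> \<open>These are the coefficients of 2 v cos u and - cos (2 u) with v = x_l / a; the
    division by 2^r prepares for the factor 2^r of the second harmonic. If \<open>l = e1\<close>,
    only + cos (2 u) is kept.\<close>
  define g1 where "g1 = (\<lambda>j x. (if l = e1 then 0 else 2 / a) * (st j x * x $ l))"
  define g2 where "g2 = (\<lambda>j x. (if l = e1 then 1 else - 1) / 2 ^ r * st j x)"
  have g: "smooth_fun (g1 j)" "smooth_fun (g2 j)" for j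
    unfolding g1_def g2_def by (intro smooth_fun_mult smooth_fun_const st smooth_fun_component)+
  obtain \<delta> and h :: "(real, 'm) vec \<Rightarrow> (real, 'n) vec" where \<delta>: "0 < \<delta>" and h: "smooth_map h"
    and perp: "\<And>x \<alpha> j. x \<in> cube \<Longrightarrow> \<alpha> \<in> perp_coords r \<Longrightarrow> \<bar>jet r h x \<alpha> j\<bar> < \<epsilon> / 2"
    and pure: "\<And>x j. x \<in> cube \<Longrightarrow> \<bar>jet r h x (pure1 r) j -
       (g1 j x * cos (x $ e1 / \<delta>) + 2 ^ r * g2 j x * cos (2 * (x $ e1 / \<delta>)))\<bar> < \<epsilon> / 2"
    and zero: "\<And>W x \<alpha> j. open W \<Longrightarrow> \<forall>y\<in>W. \<forall>j. g1 j y = 0 \<and> g2 j y = 0 \<Longrightarrow> x \<in> W \<Longrightarrow>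
       jet r h x \<alpha> j = 0"
    by (rule oscillation_jet[where ?g1.0 = g1 and ?g2.0 = g2 and \<eta> = "\<epsilon> / 2" and r = r, OF g half_gt_zero[OF \<open>\<epsilon> > 0\<close>]], rule that)
  define \<Psi> where "\<Psi> = (\<lambda>t x. t * b * (\<psi> x * cos (x $ e1 / \<delta>)))"
  define F where "F = (\<lambda>t x. x + \<Psi> t x *\<^sub>R axis l 1)"
  have cosx: "smooth_fun (\<lambda>x :: (real, 'm) vec. cos (x $ e1 / \<delta>))"
    unfolding divide_inverse by (intro smooth_fun_cos smooth_fun_mult smooth_fun_const smooth_fun_component)
  have \<Psi>: "smooth_fun (\<Psi> t)" for t
    unfolding \<Psi>_def by (intro smooth_fun_mult smooth_fun_const \<psi> cosx)
  have \<Psi>_le: "\<bar>\<Psi> t x\<bar> \<le> a" if "t \<in> {0..1}" for t x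
  proof -
    have "\<bar>\<Psi> t x\<bar> \<le> 1 * a * (1 * 1)"
      unfolding \<Psi>_def abs_mult using that b a \<psi>_le by (intro mult_mono) auto
    then show ?thesis by simp
  qed
  have \<Psi>_deriv: "\<bar>dirderiv (axis l 1) (\<Psi> t) x\<bar> \<le> 1 / 2" if t: "t \<in> {0..1}" for t x
  proof -
    have "(\<Psi> t has_derivative (\<lambda>v. t * b * (\<psi> x * (- sin (x $ e1 / \<delta>) * (v $ e1 / \<delta>)) +
        dirderiv v \<psi> x * cos (x $ e1 / \<delta>)))) (at x)"
      unfolding \<Psi>_def
      by (intro has_derivative_mult_right has_derivative_mult has_derivative_dirderiv
          smooth_fun_differentiable \<psi>)
        (use \<delta> in \<open>auto intro!: derivative_eq_intros bounded_linear_imp_has_derivative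
          bounded_linear_vec_nth\<close>)
    then have "dirderiv (axis l 1) (\<Psi> t) x = t * b * (\<psi> x * (- sin (x $ e1 / \<delta>) * (axis l 1 $ e1 / \<delta>)) +
        dirderiv (axis l 1) \<psi> x * cos (x $ e1 / \<delta>))"
      by (rule dirderiv_eq)
    \<comment> \<open>The term containing 1/\<delta> disappears: either \<open>b = 0\<close>, or
      \<open>l \<noteq> e1\<close> and the displacement direction has no first component.\<close>
    also have "\<dots> = t * b * (dirderiv (axis l 1) \<psi> x * cos (x $ e1 / \<delta>))"
      by (simp add: b_def axis_def)
    also have "\<bar>\<dots>\<bar> \<le> 1 * a * (B * 1)"
      unfolding abs_mult using t b a B by (intro mult_mono) auto
    finally show ?thesis using aB by simp
  qed
  have out: "\<Psi> t x = 0" if "c3 \<le> \<bar>x $ i\<bar>" for t x i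
    using cube_cutoff_eq_0[OF pos(2) that] by (simp add: \<Psi>_def \<psi>_def)
  have "isotopy F"
    unfolding isotopy_def
  proof (intro conjI ballI)
    have comp: "smooth_fun (\<lambda>p :: real \<times> (real, 'm) vec. snd p $ i)" for i
      by (intro smooth_fun_linear bounded_linear_compose[OF bounded_linear_vec_nth bounded_linear_snd])
    have "smooth_fun (\<lambda>p :: real \<times> (real, 'm) vec. \<Psi> (fst p) (snd p))"
      unfolding \<Psi>_def \<psi>_def divide_inverse
      by (intro smooth_fun_mult smooth_fun_const smooth_fun_cos smooth_fun_cube_cutoff pos c3 comp
          smooth_fun_linear bounded_linear_fst)
    then show "smooth_map (\<lambda>p. F (fst p) (snd p))"
      unfolding F_def by (intro smooth_map_vecI)
        (simp, intro smooth_fun_add smooth_fun_mult smooth_fun_const comp)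
    show "F 0 x = x" for x by (simp add: F_def \<Psi>_def)
    show "diffeo_cube (F t)" if "t \<in> {0..1}" for t
      unfolding F_def
    proof (rule shear_diffeo_cube[OF el \<Psi> \<Psi>_deriv[OF that] \<Psi>_le[OF that]])
      show "\<Psi> t x = 0" if "x \<notin> cube" for x
        using cube_cutoff_eq_0_outside[OF pos(2) less_imp_le[OF c3(2)] that]
        by (simp add: \<Psi>_def \<psi>_def)
    qed
  qed
  have graph: "g1 j y * cos (y $ e1 / \<delta>) + 2 ^ r * g2 j y * cos (2 * (y $ e1 / \<delta>)) = st j y"
    if x: "x \<in> subcube k" and y: "y = F 1 x" for x y j
  proof (cases "\<exists>i. c2 \<le> \<bar>y $ i\<bar>")
    case True
    then have "st j y = 0" using st(3) by blast
    then show ?thesis by (simp add: g1_def g2_def)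
  next
    case False
    have xl: "x $ l = 0"
      using x assms(1) crank_Max[where 'm='m] by (simp add: subcube_def l_def)
    have y_comp: "y $ i = (if i = l then \<Psi> 1 x else x $ i)" for i
      using xl by (simp add: y F_def axis_def)
    \<comment> \<open>The shear changes only coordinate \<open>l\<close>, which is 0 at
      \<open>x\<close>, so the bounds on \<open>y\<close> carry over to \<open>x\<close> and place
      it on the plateau of the cutoff.\<close>
    have "\<bar>x $ i\<bar> \<le> c2" for i
      using False xl pos by (cases "i = l") (auto simp: y_comp not_le dest: spec[of _ i])
    then have "\<psi> x = 1" unfolding \<psi>_def using pos c3 by (intro cube_cutoff_eq_1)
    then have yl: "y $ l = b * cos (x $ e1 / \<delta>)" by (simp add: y_comp \<Psi>_def)
    show ?thesis
    proof (cases "l = e1")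
      case True
      \<comment> \<open>Here \<open>b = 0\<close> gives \<open>y $ e1 = 0\<close>, where the cosine
        of the second harmonic is 1.\<close>
      then show ?thesis using yl by (simp add: g1_def g2_def b_def)
    next
      case False
      \<comment> \<open>\<open>2 v cos u - cos (2 u) = 1\<close> on the graph \<open>v = cos u\<close>\<close>
      define \<theta> where "\<theta> = y $ e1 / \<delta>"
      have "y $ l = a * cos \<theta>" using yl False by (simp add: y_comp \<theta>_def b_def)
      then have "g1 j y = st j y * (2 * cos \<theta>)" using False a by (simp add: g1_def)
      moreover have "2 ^ r * g2 j y = - st j y" using False by (simp add: g2_def)
      ultimately show ?thesis
        unfolding \<theta>_def[symmetric] cos_double_cos by (simp add: power2_eq_square algebra_simps)
    qed
  qed
  \<comment> \<open>The estimate holds on the image of the subcube, with half of \<epsilon> spent on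
    the smooth approximation and half on the oscillation error. Continuity of \<open>d\<close>
    extends the strict inequality to a relatively open neighborhood.\<close>
  define d where "d = (\<lambda>j x. jet r h x (pure1 r) j - s j x)"
  have near: "F 1 x \<in> cube \<and> \<bar>d j (F 1 x)\<bar> < \<epsilon>" if "x \<in> subcube k" for x j
  proof -
    have "F 1 ` cube = cube"
      using \<open>isotopy F\<close> unfolding isotopy_def diffeo_cube_def by simp
    then have "F 1 x \<in> cube" using that unfolding subcube_def by blast
    then show ?thesis
      using pure[of "F 1 x" j] st(2)[of "F 1 x" j] graph[OF that refl, of j]
      unfolding d_def by linarith
  qed
  have "continuous_on cube (d j)" for j
  proof -
    have "smooth_fun (\<lambda>x. h x $ j)"
      using h by (auto simp: smooth_map_def Basis_vec_def inner_axis)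
    then have "smooth_fun (\<lambda>x. jet r h x (pure1 r) j)"
      using pure1_jet_coords[of r, where 'a='m]
      by (simp add: jet_def jet_coords_def pderiv_mi_eq smooth_fun_iter set_mi_list)
    then show ?thesis
      unfolding d_def by (intro continuous_on_diff smooth_fun_continuous_on s)
  qed
  then have "\<exists>U. open U \<and> U \<inter> cube = d j -` {- \<epsilon><..<\<epsilon>} \<inter> cube" for j
    using open_greaterThanLessThan unfolding continuous_on_open_invariant by metis
  then obtain U where U: "\<And>j. open (U j)" "\<And>j. U j \<inter> cube = d j -` {- \<epsilon><..<\<epsilon>} \<inter> cube"
    by metis
  have near_nbhd: "\<exists>U. open U \<and> F 1 ` subcube k \<subseteq> U \<and>
        (\<forall>x\<in>U \<inter> cube. \<forall>\<alpha>\<in>jet_coords r. \<forall>j. \<bar>jet r h x \<alpha> j - \<sigma> x \<alpha> j\<bar> < \<epsilon>)"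
  proof (intro exI[of _ "\<Inter>j. U j"] conjI ballI allI)
    show "open (\<Inter>j. U j)" using U(1) by (intro open_INT) auto
    show "F 1 ` subcube k \<subseteq> (\<Inter>j. U j)"
    proof safe
      fix x :: "(real, 'm) vec" and j assume "x \<in> subcube k"
      from near[OF this, of j] have "F 1 x \<in> d j -` {- \<epsilon><..<\<epsilon>} \<inter> cube" by auto
      then show "F 1 x \<in> U j" using U(2)[of j] by blast
    qed
    fix x and \<alpha> :: "'m \<Rightarrow> nat" and j assume x: "x \<in> (\<Inter>j. U j) \<inter> cube" and \<alpha>: "\<alpha> \<in> jet_coords r"
    show "\<bar>jet r h x \<alpha> j - \<sigma> x \<alpha> j\<bar> < \<epsilon>"
    proof (cases "\<alpha> = pure1 r")
      case True
      have "x \<in> d j -` {- \<epsilon><..<\<epsilon>}" using x U(2)[of j] by blast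
      then show ?thesis using True by (auto simp: d_def s_def)
    next
      case False
      then have \<alpha>: "\<alpha> \<in> perp_coords r" using \<alpha> by (simp add: jet_coords_eq)
      then show ?thesis using perp[of x \<alpha> j] bspec[OF bspec[OF assms(4)] \<alpha>] \<open>\<epsilon> > 0\<close> x by simp
    qed
  qed
  \<comment> \<open>Beyond \<open>c3\<close> both the displacement and the amplitudes vanish.
    Openness of \<open>W\<close> makes all derivatives of \<open>h\<close> vanish there too.\<close>
  define W where "W = (\<Union>i. {x :: (real, 'm) vec. c3 < \<bar>x $ i\<bar>})"
  have W: "open W"
    unfolding W_def by (intro open_UN ballI open_Collect_less continuous_intros)
  have boundary_nbhd: "\<exists>U. open U \<and> frontier cube \<subseteq> U \<and>
        (\<forall>t\<in>{0..1}. \<forall>x\<in>U \<inter> cube. F t x = x) \<and>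
        (\<forall>x\<in>U \<inter> cube. \<forall>\<alpha>\<in>jet_coords r. \<forall>j. jet r h x \<alpha> j = 0)"
  proof (intro exI[of _ W] conjI ballI allI)
    show "frontier cube \<subseteq> W"
    proof
      fix x :: "(real, 'm) vec" assume "x \<in> frontier cube"
      then obtain i where "\<bar>x $ i\<bar> = 1" by (auto simp: frontier_cube)
      then have "c3 < \<bar>x $ i\<bar>" using c3(2) by simp
      then show "x \<in> W" unfolding W_def by blast
    qed
    show "F t x = x" if x: "x \<in> W \<inter> cube" for t x
    proof -
      obtain i where "c3 < \<bar>x $ i\<bar>" using x unfolding W_def by blast
      then have "\<Psi> t x = 0" by (intro out[of x i]) simp
      then show ?thesis by (simp add: F_def)
    qed
    have "g1 j y = 0 \<and> g2 j y = 0" if "y \<in> W" for j y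
    proof -
      obtain i where "c3 < \<bar>y $ i\<bar>" using \<open>y \<in> W\<close> by (auto simp: W_def)
      then have "st j y = 0" using c3(1) by (intro st(3)[of y i]) auto
      then show ?thesis by (simp add: g1_def g2_def)
    qed
    then show "jet r h x \<alpha> j = 0" if "x \<in> W \<inter> cube" for x \<alpha> j
      using that by (intro zero[OF W]) auto
  qed (rule W)
  show ?thesis
  proof (intro exI[of _ F] exI[of _ h] conjI near_nbhd boundary_nbhd \<open>isotopy F\<close> h ballI allI)
    show "\<bar>jet r h x \<alpha> j\<bar> < \<epsilon>" if "x \<in> cube" "\<alpha> \<in> perp_coords r" for x j and \<alpha> :: "'m \<Rightarrow> nat"
      using perp[OF that, of j] \<open>\<epsilon> > 0\<close> by simp
    show "dist (F t x) x < \<epsilon>" if "t \<in> {0..1}" for t x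
      using \<Psi>_le[OF that, of x] a by (simp add: F_def dist_norm)
    show "frechet_derivative (F t) (at x) ` hypV = hypV" if "t \<in> {0..1}" for t x
      unfolding F_def
    proof (rule shear_image_hypV[OF \<Psi>])
      show "dirderiv (axis l 1) (\<Psi> t) x \<noteq> - 1" using \<Psi>_deriv[OF that, of x] by auto
      show "\<Psi> t = (\<lambda>_. 0)" if "l = e1" using that by (simp add: \<Psi>_def b_def)
    qed
  qed
qed

end
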